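(* If $q:P\to M$ is a finite covering, i.e. a principal bundle $(P,M,G,q,\sigma)$ with finite structure group $G$, then $C^{\infty}(P)$ is a finitely generated projective $C^{\infty}(M)$-module.
   Context: Manifolds are finite-dimensional, paracompact, second countable and smooth. $C^{\infty}(P)$, $C^\infty(M)$ are the algebras of smooth $\mathbb{C}$-valued functions, and $C^{\infty}(P)$ is a $C^{\infty}(M)$-module via $f\cdot h:=(f\circ q)\,h$ for $f\in C^\infty(M)$, $h\in C^\infty(P)$. A principal bundle $(P,M,G,q,\sigma)$ consists of manifolds $P,M$, a Lie group $G$, a smooth map $q:P\to M$ and a smooth right action $\sigma$ of $G$ on $P$ such that each $m\in M$ has an open neighbourhood $U$ with a $G$-equivariant diffeomorphism $\varphi_U:U\times G\to q^{-1}(U)$ satisfying $q\circ\varphi_U=\mathrm{pr}_U$. *)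

theory Defs
  imports "HOL-Analysis.Analysis" "HOL-Algebra.Module"
begin

section \<open>Smooth maps on subsets of Euclidean spaces\<close>

primrec Ck_on :: "nat \<Rightarrow> 'a::euclidean_space set \<Rightarrow> ('a \<Rightarrow> 'b::real_normed_vector) \<Rightarrow> bool" where
  "Ck_on 0 S f \<longleftrightarrow> continuous_on S f"
| "Ck_on (Suc k) S f \<longleftrightarrow>
     (\<forall>x\<in>S. f differentiable (at x)) \<and> (\<forall>v. Ck_on k S (\<lambda>x. frechet_derivative f (at x) v))"

text \<open>
  Charts take values in a linear subspace of a Euclidean space, because the types of class
  \<^class>\<open>euclidean_space\<close> do not include the zero-dimensional space and Lie groups may be discrete.
  On a relatively open subset of a linear subspace, having local smooth extensions to the ambient
  space is the usual notion of smoothness (compose with the orthogonal projection).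
\<close>

definition smooth_on :: "'a::euclidean_space set \<Rightarrow> ('a \<Rightarrow> 'b::real_normed_vector) \<Rightarrow> bool" where
  "smooth_on S f \<longleftrightarrow>
     (\<forall>x\<in>S. \<exists>W F. open W \<and> x \<in> W \<and> (\<forall>k. Ck_on k W F) \<and> (\<forall>y\<in>S \<inter> W. F y = f y))"

section \<open>Smooth manifolds\<close>

definition paracompact_space :: "'a topology \<Rightarrow> bool" where
  "paracompact_space X \<longleftrightarrow>
     (\<forall>\<U>. (\<forall>U\<in>\<U>. openin X U) \<and> \<Union>\<U> = topspace X \<longrightarrow>
        (\<exists>\<V>. (\<forall>V\<in>\<V>. openin X V) \<and> \<Union>\<V> = topspace X \<and>
             (\<forall>V\<in>\<V>. \<exists>U\<in>\<U>. V \<subseteq> U) \<and> locally_finite_in X \<V>))"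

record ('a, 'e) manifold =
  mtop :: "'a topology"
  model :: "'e set"
  atlas :: "('a set \<times> ('a \<Rightarrow> 'e)) set"

abbreviation points :: "('a, 'e) manifold \<Rightarrow> 'a set" where
  "points M \<equiv> topspace (mtop M)"

definition chart :: "('a, 'e::euclidean_space) manifold \<Rightarrow> 'a set \<Rightarrow> ('a \<Rightarrow> 'e) \<Rightarrow> bool" where
  "chart M U \<phi> \<longleftrightarrow>
     openin (mtop M) U \<and> openin (top_of_set (model M)) (\<phi> ` U) \<and>
     homeomorphic_map (subtopology (mtop M) U) (top_of_set (\<phi> ` U)) \<phi>"

text \<open>The atlas need not be maximal. The dimension of the manifold is that of its model space.\<close>

definition smooth_manifold :: "('a, 'e::euclidean_space) manifold \<Rightarrow> bool" where
  "smooth_manifold M \<longleftrightarrow>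
     Hausdorff_space (mtop M) \<and> paracompact_space (mtop M) \<and> second_countable (mtop M) \<and>
     subspace (model M) \<and>
     (\<forall>(U, \<phi>)\<in>atlas M. chart M U \<phi>) \<and>
     (\<Union>(U, \<phi>)\<in>atlas M. U) = points M \<and>
     (\<forall>(U, \<phi>)\<in>atlas M. \<forall>(V, \<psi>)\<in>atlas M. smooth_on (\<phi> ` (U \<inter> V)) (\<psi> \<circ> inv_into U \<phi>))"

definition smooth_map ::
    "('a, 'e::euclidean_space) manifold \<Rightarrow> ('b, 'f::euclidean_space) manifold \<Rightarrow> ('a \<Rightarrow> 'b) \<Rightarrow> bool" where
  "smooth_map M N f \<longleftrightarrow>
     continuous_map (mtop M) (mtop N) f \<and>
     (\<forall>(U, \<phi>)\<in>atlas M. \<forall>(V, \<psi>)\<in>atlas N.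
        smooth_on (\<phi> ` {x \<in> U. f x \<in> V}) (\<psi> \<circ> f \<circ> inv_into U \<phi>))"

definition diffeomorphism ::
    "('a, 'e::euclidean_space) manifold \<Rightarrow> ('b, 'f::euclidean_space) manifold \<Rightarrow> ('a \<Rightarrow> 'b) \<Rightarrow> bool" where
  "diffeomorphism M N f \<longleftrightarrow>
     smooth_map M N f \<and>
     (\<exists>g. smooth_map N M g \<and> (\<forall>x\<in>points M. g (f x) = x) \<and> (\<forall>y\<in>points N. f (g y) = y))"

definition open_submanifold :: "('a, 'e) manifold \<Rightarrow> 'a set \<Rightarrow> ('a, 'e) manifold" where
  "open_submanifold M W =
     \<lparr>mtop = subtopology (mtop M) W, model = model M, atlas = (\<lambda>(U, \<phi>). (U \<inter> W, \<phi>)) ` atlas M\<rparr>"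

definition prod_manifold ::
    "('a, 'e) manifold \<Rightarrow> ('b, 'f) manifold \<Rightarrow> ('a \<times> 'b, 'e \<times> 'f) manifold" where
  "prod_manifold M N =
     \<lparr>mtop = prod_topology (mtop M) (mtop N), model = model M \<times> model N,
      atlas = {(U \<times> V, map_prod \<phi> \<psi>) | U \<phi> V \<psi>. (U, \<phi>) \<in> atlas M \<and> (V, \<psi>) \<in> atlas N}\<rparr>"

section \<open>Lie groups and principal bundles\<close>

record ('g, 'e) lie_group = "'g monoid" +
  lie_manifold :: "('g, 'e) manifold"

definition is_lie_group :: "('g, 'e::euclidean_space) lie_group \<Rightarrow> bool" where
  "is_lie_group G \<longleftrightarrow>
     group G \<and> smooth_manifold (lie_manifold G) \<and> points (lie_manifold G) = carrier G \<and>
     smooth_map (prod_manifold (lie_manifold G) (lie_manifold G)) (lie_manifold G)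
       (\<lambda>(g, h). g \<otimes>\<^bsub>G\<^esub> h) \<and>
     smooth_map (lie_manifold G) (lie_manifold G) (\<lambda>g. inv\<^bsub>G\<^esub> g)"

definition smooth_right_action ::
    "('p, 'e::euclidean_space) manifold \<Rightarrow> ('g, 'h::euclidean_space) lie_group \<Rightarrow>
     ('p \<Rightarrow> 'g \<Rightarrow> 'p) \<Rightarrow> bool" where
  "smooth_right_action P G \<sigma> \<longleftrightarrow>
     smooth_map (prod_manifold P (lie_manifold G)) P (\<lambda>(p, g). \<sigma> p g) \<and>
     (\<forall>p\<in>points P. \<sigma> p \<one>\<^bsub>G\<^esub> = p) \<and>
     (\<forall>p\<in>points P. \<forall>g\<in>carrier G. \<forall>h\<in>carrier G. \<sigma> (\<sigma> p g) h = \<sigma> p (g \<otimes>\<^bsub>G\<^esub> h))"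

definition principal_bundle ::
    "('p, 'e::euclidean_space) manifold \<Rightarrow> ('m, 'f::euclidean_space) manifold \<Rightarrow>
     ('g, 'h::euclidean_space) lie_group \<Rightarrow> ('p \<Rightarrow> 'm) \<Rightarrow> ('p \<Rightarrow> 'g \<Rightarrow> 'p) \<Rightarrow> bool" where
  "principal_bundle P M G q \<sigma> \<longleftrightarrow>
     smooth_manifold P \<and> smooth_manifold M \<and> is_lie_group G \<and>
     smooth_map P M q \<and> smooth_right_action P G \<sigma> \<and>
     (\<forall>m\<in>points M. \<exists>U \<phi>. openin (mtop M) U \<and> m \<in> U \<and>
        diffeomorphism (prod_manifold (open_submanifold M U) (lie_manifold G))
          (open_submanifold P {p \<in> points P. q p \<in> U}) \<phi> \<and>
        (\<forall>x\<in>U. \<forall>g\<in>carrier G. q (\<phi> (x, g)) = x) \<and>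
        (\<forall>x\<in>U. \<forall>g\<in>carrier G. \<forall>h\<in>carrier G. \<phi> (x, g \<otimes>\<^bsub>G\<^esub> h) = \<sigma> (\<phi> (x, g)) h))"

section \<open>Algebras of smooth functions\<close>

text \<open>
  Functions on a manifold are represented by functions on the whole type with the value
  \<^const>\<open>undefined\<close> off the manifold, so that equality of functions on the manifold is equality in HOL.
\<close>

definition smooth_functions :: "('a, 'e::euclidean_space) manifold \<Rightarrow> ('a \<Rightarrow> complex) set" where
  "smooth_functions M =
     {f \<in> extensional (points M). \<forall>(U, \<phi>)\<in>atlas M. smooth_on (\<phi> ` U) (f \<circ> inv_into U \<phi>)}"

definition smooth_ring :: "('a, 'e::euclidean_space) manifold \<Rightarrow> ('a \<Rightarrow> complex) ring" where
  "smooth_ring M =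
     \<lparr>carrier = smooth_functions M,
      mult = (\<lambda>f g. \<lambda>x\<in>points M. f x * g x),
      one = (\<lambda>x\<in>points M. 1),
      zero = (\<lambda>x\<in>points M. 0),
      add = (\<lambda>f g. \<lambda>x\<in>points M. f x + g x)\<rparr>"

definition smooth_module ::
    "('p, 'e::euclidean_space) manifold \<Rightarrow> ('p \<Rightarrow> 'm) \<Rightarrow> ('m \<Rightarrow> complex, 'p \<Rightarrow> complex) module" where
  "smooth_module P q =
     \<lparr>carrier = smooth_functions P,
      mult = (\<lambda>f g. \<lambda>p\<in>points P. f p * g p),
      one = (\<lambda>p\<in>points P. 1),
      zero = (\<lambda>p\<in>points P. 0),
      add = (\<lambda>f g. \<lambda>p\<in>points P. f p + g p),
      smult = (\<lambda>f h. \<lambda>p\<in>points P. f (q p) * h p)\<rparr>"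

section \<open>Finitely generated and projective modules\<close>

definition finitely_generated_module :: "'r ring \<Rightarrow> ('r, 'a) module \<Rightarrow> bool" where
  "finitely_generated_module R X \<longleftrightarrow>
     Module.module R X \<and>
     (\<exists>S. finite S \<and> S \<subseteq> carrier X \<and>
        (\<forall>x\<in>carrier X. \<exists>c\<in>S \<rightarrow> carrier R. x = (\<Oplus>\<^bsub>X\<^esub>s\<in>S. c s \<odot>\<^bsub>X\<^esub> s)))"

definition module_homs :: "'r ring \<Rightarrow> ('r, 'a) module \<Rightarrow> ('r, 'b) module \<Rightarrow> ('a \<Rightarrow> 'b) set" where
  "module_homs R X Y =
     {f \<in> carrier X \<rightarrow> carrier Y.
        (\<forall>x\<in>carrier X. \<forall>y\<in>carrier X. f (x \<oplus>\<^bsub>X\<^esub> y) = f x \<oplus>\<^bsub>Y\<^esub> f y) \<and>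
        (\<forall>r\<in>carrier R. \<forall>x\<in>carrier X. f (r \<odot>\<^bsub>X\<^esub> x) = r \<odot>\<^bsub>Y\<^esub> f x)}"

text \<open>
  The lifting property quantifies over all modules, which HOL allows only for fixed element types;
  these are parameters here. Projectivity is the statement with type variables for both of them.
\<close>

definition projective_module ::
    "'b itself \<Rightarrow> 'c itself \<Rightarrow> 'r ring \<Rightarrow> ('r, 'a) module \<Rightarrow> bool" where
  "projective_module _ _ R X \<longleftrightarrow>
     Module.module R X \<and>
     (\<forall>(Y :: ('r, 'b) module) (Z :: ('r, 'c) module) f g.
        Module.module R Y \<and> Module.module R Z \<and>
        g \<in> module_homs R Y Z \<and> g ` carrier Y = carrier Z \<and> f \<in> module_homs R X Z \<longrightarrow>
        (\<exists>h\<in>module_homs R X Y. \<forall>x\<in>carrier X. g (h x) = f x))"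

end

theory Submission
  imports Defs
begin

text \<open>
  The module has a finite dual basis as soon as the delta function of the fibres is a kernel of
  finite rank. Suppose that \<open>\<Sum>\<^bsub>b\<in>S\<^esub> a\<^sub>b(x) b(y)\<close> is 1 for \<open>x = y\<close> and 0 for distinct points \<open>x\<close>, \<open>y\<close> of one
  fibre, where \<open>S\<close> is finite and all functions are smooth on \<open>P\<close>. Then every smooth \<open>h\<close> is the sum of
  the \<open>(\<tau>(a\<^sub>b h) \<circ> q) b\<close>, where \<open>\<tau>\<close> is summation over the fibres; \<open>\<tau>\<close> maps smooth functions on \<open>P\<close> to
  smooth functions on \<open>M\<close> because locally it is a finite sum over sheets (\<open>fibre_sum_smooth\<close>). So
  the \<open>b\<close> generate, the functionals \<open>h \<mapsto> \<tau>(a\<^sub>b h)\<close> are linear over the functions on \<open>M\<close>, and a module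
  with such a dual basis is projective (\<open>dual_basis_imp_projective\<close>).

  To find the kernel (\<open>separable_fibre_delta\<close>), let \<open>F\<close> be a smooth map from \<open>P\<close> to a Euclidean space
  with \<open>F x \<noteq> F (x g)\<close> for all \<open>x\<close> and all \<open>g \<noteq> 1\<close>. The product over \<open>g \<noteq> 1\<close> of \<open>\<langle>F x - F (x g), F y - F
  (x g)\<rangle> / |F x - F (x g)|\<^sup>2\<close> is 1 at \<open>y = x\<close> and vanishes at the other points of the fibre, and it
  is a polynomial in the coordinates of \<open>F y\<close> with coefficients that are smooth in \<open>x\<close>.

  The existence of \<open>F\<close> is the geometric part (\<open>generic_smooth_map\<close>, \<open>fibre_separating_map\<close>). The
  manifold \<open>M\<close> need not be compact, so finiteness cannot come from a finite subcover; it is the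
  dimension of \<open>P\<close> that bounds the number of coordinates. There is a locally finite sequence of
  smooth functions \<open>\<psi>\<^sub>k\<close> that together separate the points of each fibre, and \<open>F\<close> is sought in the
  form \<open>\<Sum> \<psi>\<^sub>k v\<^sub>k\<close>. Adding the term \<open>\<psi>\<^sub>k v\<^sub>k\<close> to the partial sum \<open>F'\<close> creates a coincidence at \<open>x\<close> and \<open>x g\<close>
  only if \<open>v\<^sub>k = (F' x - F' (x g)) / (\<psi>\<^sub>k(x g) - \<psi>\<^sub>k x)\<close>. The right-hand side is a smooth function on
  an open subset of \<open>P\<close>, so if the target has larger dimension than the Euclidean space containing
  the charts of \<open>P\<close>, then its values form a null set that \<open>v\<^sub>k\<close> can avoid. Every term thus preserves
  the separation achieved before and adds that of \<open>\<psi>\<^sub>k\<close>.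
\<close>

section \<open>Calculus of smooth functions on Euclidean spaces\<close>

lemma Ck_on_subset: "Ck_on k S f \<Longrightarrow> T \<subseteq> S \<Longrightarrow> Ck_on k T f"
  by (induction k arbitrary: f) (auto intro: continuous_on_subset)

lemma Ck_on_cong:
  assumes "open S" "\<And>x. x \<in> S \<Longrightarrow> f x = g x"
  shows "Ck_on k S f \<longleftrightarrow> Ck_on k S g"
  using assms(2)
proof (induction k arbitrary: f g)
  case 0
  then show ?case by (simp cong: continuous_on_cong)
next
  case (Suc k)
  have d: "(f has_derivative D) (at x) \<longleftrightarrow> (g has_derivative D) (at x)" if "x \<in> S" for x D
    using has_derivative_transform_within_open[of f D x UNIV S g]
      has_derivative_transform_within_open[of g D x UNIV S f] assms(1) that Suc.prems by auto
  have "Ck_on k S (\<lambda>x. frechet_derivative f (at x) v) \<longleftrightarrow>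
        Ck_on k S (\<lambda>x. frechet_derivative g (at x) v)" for v
    by (rule Suc.IH) (simp add: frechet_derivative_def d)
  then show ?case
    using d by (auto simp: differentiable_def)
qed

text \<open>
  Computing with \<^const>\<open>Ck_on\<close> needs derivatives in whatever form the calculus rules produce them,
  rather than as \<^const>\<open>frechet_derivative\<close>; on an open set the two may be exchanged.
\<close>

lemma Ck_on_SucI:
  assumes "open S" "\<And>x. x \<in> S \<Longrightarrow> (f has_derivative f' x) (at x)"
    and "\<And>v. Ck_on k S (\<lambda>x. f' x v)"
  shows "Ck_on (Suc k) S f"
proof -
  have "Ck_on k S (\<lambda>x. frechet_derivative f (at x) v)" for v
    using assms(3)[of v] frechet_derivative_at[OF assms(2)]
    by (subst Ck_on_cong[OF assms(1), where g = "\<lambda>x. f' x v"]) auto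
  then show ?thesis
    using assms(2) by (auto simp: differentiable_def)
qed

lemma Ck_on_Suc_has_derivative:
  "Ck_on (Suc k) S f \<Longrightarrow> x \<in> S \<Longrightarrow> (f has_derivative frechet_derivative f (at x)) (at x)"
  using frechet_derivative_works by auto

lemma Ck_on_Suc_imp: "Ck_on (Suc k) S f \<Longrightarrow> Ck_on k S f"
proof (induction k arbitrary: f)
  case 0
  then show ?case
    by (auto intro!: continuous_at_imp_continuous_on differentiable_imp_continuous_within)
next
  case (Suc k)
  then show ?case by (metis Ck_on.simps(2))
qed

lemma Ck_on_imp_continuous: "Ck_on k S f \<Longrightarrow> continuous_on S f"
  by (induction k) (auto dest: Ck_on_Suc_imp simp del: Ck_on.simps(2))

lemma Ck_on_const: "open S \<Longrightarrow> Ck_on k S (\<lambda>x. c)"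
proof (induction k arbitrary: c)
  case (Suc k)
  then show ?case by (intro Ck_on_SucI[where f' = "\<lambda>x v. 0"]) auto
qed auto

lemma Ck_on_linear:
  assumes "bounded_linear L" "open S" "Ck_on k S f"
  shows "Ck_on k S (\<lambda>x. L (f x))"
  using assms(3)
proof (induction k arbitrary: f)
  case 0
  then show ?case using assms(1) by (simp add: bounded_linear.continuous_on)
next
  case (Suc k)
  show ?case
  proof (rule Ck_on_SucI[OF assms(2)])
    show "((\<lambda>x. L (f x)) has_derivative (\<lambda>v. L (frechet_derivative f (at x) v))) (at x)" if "x \<in> S" for x
      by (rule bounded_linear.has_derivative[OF assms(1) Ck_on_Suc_has_derivative[OF Suc.prems that]])
    show "Ck_on k S (\<lambda>x. L (frechet_derivative f (at x) v))" for v
      using Suc by simp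
  qed
qed

lemma Ck_on_id: "open S \<Longrightarrow> Ck_on k S (\<lambda>x. x)"
proof (cases k)
  case (Suc k)
  assume "open S"
  then have "Ck_on (Suc k) S (\<lambda>x. x)"
    by (intro Ck_on_SucI[where f' = "\<lambda>x v. v"] Ck_on_const) auto
  with Suc show ?thesis by simp
qed auto

lemma Ck_on_add:
  assumes "open S" "Ck_on k S f" "Ck_on k S g"
  shows "Ck_on k S (\<lambda>x. f x + g x)"
  using assms(2,3)
proof (induction k arbitrary: f g)
  case 0
  then show ?case by (simp add: continuous_on_add)
next
  case (Suc k)
  show ?case
  proof (rule Ck_on_SucI[OF assms(1)])
    show "((\<lambda>x. f x + g x) has_derivative
        (\<lambda>v. frechet_derivative f (at x) v + frechet_derivative g (at x) v)) (at x)" if "x \<in> S" for x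
      using Suc.prems that by (intro has_derivative_add Ck_on_Suc_has_derivative)
    show "Ck_on k S (\<lambda>x. frechet_derivative f (at x) v + frechet_derivative g (at x) v)" for v
      using Suc by simp
  qed
qed

lemma Ck_on_sum:
  assumes "open S" "\<And>i. i \<in> I \<Longrightarrow> Ck_on k S (f i)"
  shows "Ck_on k S (\<lambda>x. \<Sum>i\<in>I. f i x)"
  using assms(2)
  by (induction I rule: infinite_finite_induct) (auto intro: Ck_on_const Ck_on_add assms(1))

lemma Ck_on_bilinear:
  assumes "bounded_bilinear pr" "open S" "Ck_on k S f" "Ck_on k S g"
  shows "Ck_on k S (\<lambda>x. pr (f x) (g x))"
  using assms(3,4)
proof (induction k arbitrary: f g)
  case 0
  then show ?case using assms(1) by (simp add: bounded_bilinear.continuous_on)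
next
  case (Suc k)
  show ?case
  proof (rule Ck_on_SucI[OF assms(2)])
    show "((\<lambda>x. pr (f x) (g x)) has_derivative
        (\<lambda>v. pr (f x) (frechet_derivative g (at x) v) + pr (frechet_derivative f (at x) v) (g x))) (at x)"
      if "x \<in> S" for x
      using Suc.prems that
      by (intro bounded_bilinear.FDERIV[OF assms(1)] Ck_on_Suc_has_derivative)
    show "Ck_on k S (\<lambda>x. pr (f x) (frechet_derivative g (at x) v) +
        pr (frechet_derivative f (at x) v) (g x))" for v
      using Suc.prems Ck_on_Suc_imp[of k S f] Ck_on_Suc_imp[of k S g]
      by (intro Ck_on_add Suc.IH assms(2)) auto
  qed
qed

text \<open>
  Expanding the inner derivative in the standard basis turns the chain rule into a sum of
  products of functions that are smooth by induction.
\<close>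

lemma Ck_on_compose:
  fixes f :: "'a::euclidean_space \<Rightarrow> 'b::euclidean_space" and g :: "'b \<Rightarrow> 'c::real_normed_vector"
  assumes "open S" "open T" "f ` S \<subseteq> T" "Ck_on k S f" "Ck_on k T g"
  shows "Ck_on k S (\<lambda>x. g (f x))"
  using assms(4,5)
proof (induction k arbitrary: g)
  case 0
  then show ?case using assms(3) by (auto intro: continuous_on_compose2)
next
  case (Suc k)
  let ?f' = "\<lambda>x. frechet_derivative f (at x)" and ?g' = "\<lambda>y. frechet_derivative g (at y)"
  show ?case
  proof (rule Ck_on_SucI[OF assms(1)])
    fix x assume "x \<in> S"
    then have f: "(f has_derivative ?f' x) (at x)" and g: "(g has_derivative ?g' (f x)) (at (f x))"
      using assms(3) Suc.prems by (auto intro!: Ck_on_Suc_has_derivative simp del: Ck_on.simps(2))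
    have eq: "?g' (f x) w = (\<Sum>b\<in>Basis. (w \<bullet> b) *\<^sub>R ?g' (f x) b)" for w
    proof -
      have "linear (?g' (f x))"
        using g by (rule has_derivative_linear)
      then have "(\<Sum>b\<in>Basis. (w \<bullet> b) *\<^sub>R ?g' (f x) b) = ?g' (f x) (\<Sum>b\<in>Basis. (w \<bullet> b) *\<^sub>R b)"
        by (simp add: linear_sum linear_scale)
      then show ?thesis by (simp add: euclidean_representation)
    qed
    show "((\<lambda>x. g (f x)) has_derivative
        (\<lambda>v. \<Sum>b\<in>Basis. (?f' x v \<bullet> b) *\<^sub>R ?g' (f x) b)) (at x)"
      by (rule has_derivative_eq_rhs[OF has_derivative_compose[OF f g]]) (rule ext, rule eq)
  next
    fix v
    have "Ck_on k S (\<lambda>x. ?g' (f x) b)" for b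
      using Suc.prems Ck_on_Suc_imp[of k S f] by (intro Suc.IH) auto
    moreover have "Ck_on k S (\<lambda>x. ?f' x v \<bullet> b)" for b
      using Suc.prems by (intro Ck_on_linear[OF bounded_linear_inner_left] assms(1)) auto
    ultimately show "Ck_on k S (\<lambda>x. \<Sum>b\<in>Basis. (?f' x v \<bullet> b) *\<^sub>R ?g' (f x) b)"
      by (intro Ck_on_sum Ck_on_bilinear[OF bounded_bilinear_scaleR] assms(1))
  qed
qed

lemma Ck_on_inverse: "Ck_on k (- {0}) (inverse :: real \<Rightarrow> real)"
proof (induction k)
  case 0
  then show ?case by (auto intro: continuous_intros)
next
  case (Suc k)
  show ?case
  proof (rule Ck_on_SucI)
    show "(inverse has_derivative (\<lambda>v. - (inverse x * v * inverse x))) (at x)"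
      if "x \<in> - {0}" for x :: real
      using that by (intro has_derivative_inverse') auto
    show "Ck_on k (- {0}) (\<lambda>x. - (inverse x * v * inverse x))" for v :: real
      by (intro Ck_on_linear[OF bounded_linear_minus[OF bounded_linear_ident]]
          Ck_on_bilinear[OF bounded_bilinear_mult] Ck_on_const Suc) auto
  qed auto
qed

text \<open>
  The exponential beats every polynomial. For the polynomial \<open>s p(s)\<close> this is the
  differentiability at 0 of the functions in the next lemma.
\<close>

lemma flat_poly_tendsto_0: "((\<lambda>t. poly p (inverse t) * exp (- inverse t)) \<longlongrightarrow> 0) (at_right (0::real))"
proof -
  have "((\<lambda>s. poly p s * exp (- s)) \<longlongrightarrow> 0) at_top"
  proof -
    have "((\<lambda>s. \<Sum>i\<le>degree p. coeff p i * (s ^ i / exp s)) \<longlongrightarrow> (\<Sum>i\<le>degree p. coeff p i * 0)) at_top"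
      by (intro tendsto_sum tendsto_mult tendsto_const tendsto_power_div_exp_0)
    moreover have "(\<Sum>i\<le>degree p. coeff p i * (s ^ i / exp s)) = poly p s * exp (- s)" for s :: real
      by (simp add: poly_altdef sum_distrib_right exp_minus divide_inverse mult.assoc)
    ultimately show ?thesis by simp
  qed
  from filterlim_compose[OF this filterlim_inverse_at_top_right] show ?thesis .
qed

text \<open>
  The functions \<open>p (1/t) exp (-1/t)\<close>, extended by zero to \<open>t \<le> 0\<close>, are closed under differentiation,
  the derivative having the polynomial \<open>s\<^sup>2 (p(s) - p'(s))\<close>, where \<open>s = 1/t\<close>, in place of \<open>p(s)\<close>; so
  all of them are smooth.
\<close>

lemma Ck_on_flat_poly:
  "Ck_on k UNIV (\<lambda>t::real. if 0 < t then poly p (inverse t) * exp (- inverse t) else 0)"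
proof (induction k arbitrary: p)
  have fd: "((\<lambda>t::real. if 0 < t then poly p (inverse t) * exp (- inverse t) else 0)
      has_real_derivative
      (if 0 < x then poly ([:0, 0, 1:] * (p - pderiv p)) (inverse x) * exp (- inverse x) else 0)) (at x)"
    (is "(?f has_real_derivative ?f' x) _") for p x
  proof -
    consider "x < 0" | "x > 0" | "x = 0" by linarith
    then show ?thesis
    proof cases
      case 1
      have "((\<lambda>t. 0::real) has_real_derivative 0) (at x)" by simp
      then have "(?f has_real_derivative 0) (at x)"
        by (rule has_field_derivative_transform_within[where d = "- x"]) (use 1 in \<open>auto simp: dist_real_def\<close>)
      then show ?thesis using 1 by simp
    next
      case 2
      have "((\<lambda>t. poly p (inverse t) * exp (- inverse t)) has_real_derivative ?f' x) (at x)"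
        using 2 by (auto intro!: derivative_eq_intros poly_DERIV[THEN DERIV_chain2]
            simp: field_simps power2_eq_square)
      then show ?thesis
        by (rule has_field_derivative_transform_within[where d = x]) (use 2 in \<open>auto simp: dist_real_def\<close>)
    next
      case 3
      have "((\<lambda>t. ?f t / t) \<longlongrightarrow> 0) (at_right 0)"
        by (rule Lim_transform_eventually[OF flat_poly_tendsto_0[of "[:0, 1:] * p"]])
          (rule eventually_mono[OF eventually_at_right_less], simp add: field_simps)
      moreover have "((\<lambda>t. ?f t / t) \<longlongrightarrow> 0) (at_left 0)"
        by (rule Lim_transform_eventually[OF tendsto_const]) (simp add: eventually_at_filter)
      ultimately have "((\<lambda>t. ?f t / t) \<longlongrightarrow> 0) (at 0)"
        by (simp add: filterlim_at_split)
      then show ?thesis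
        using 3 by (simp add: DERIV_def cong: if_cong)
    qed
  qed
  {
    case 0
    show ?case
      using fd by (auto intro!: continuous_at_imp_continuous_on dest: DERIV_isCont)
  next
    case (Suc k)
    show ?case
    proof (rule Ck_on_SucI)
      show "((\<lambda>t. if 0 < t then poly p (inverse t) * exp (- inverse t) else 0) has_derivative
        (*) (if 0 < x then poly ([:0, 0, 1:] * (p - pderiv p)) (inverse x) * exp (- inverse x) else 0))
         (at x)" for x :: real
        using fd[of p x] by (simp only: has_field_derivative_def)
      show "Ck_on k UNIV (\<lambda>x. (if 0 < x then poly ([:0, 0, 1:] * (p - pderiv p)) (inverse x) *
        exp (- inverse x) else 0) * v)" for v :: real
        by (intro Ck_on_bilinear[OF bounded_bilinear_mult] Ck_on_const Suc) auto
    qed auto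
  }
qed

lemma smooth_onI:
  "(\<And>x. x \<in> S \<Longrightarrow> \<exists>W F. open W \<and> x \<in> W \<and> (\<forall>k. Ck_on k W F) \<and> (\<forall>y\<in>S \<inter> W. F y = f y)) \<Longrightarrow>
   smooth_on S f"
  by (simp add: smooth_on_def)

lemma smooth_onE:
  assumes "smooth_on S f" "x \<in> S"
  obtains W F where "open W" "x \<in> W" "\<And>k. Ck_on k W F" "\<And>y. y \<in> S \<Longrightarrow> y \<in> W \<Longrightarrow> F y = f y"
  using assms unfolding smooth_on_def by (metis IntI)

lemma smooth_on_subset:
  assumes "smooth_on S f" "T \<subseteq> S"
  shows "smooth_on T f"
proof (rule smooth_onI)
  fix x assume "x \<in> T"
  with assms(2) have "x \<in> S" by auto
  obtain W F where "open W" "x \<in> W" "\<And>k. Ck_on k W F" "\<And>y. y \<in> S \<Longrightarrow> y \<in> W \<Longrightarrow> F y = f y"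
    using smooth_onE[OF assms(1) \<open>x \<in> S\<close>] by blast
  with assms(2) show "\<exists>W F. open W \<and> x \<in> W \<and> (\<forall>k. Ck_on k W F) \<and> (\<forall>y\<in>T \<inter> W. F y = f y)"
    by (intro exI[of _ W] exI[of _ F]) (simp add: subset_eq)
qed

lemma smooth_on_cong:
  assumes "\<And>x. x \<in> S \<Longrightarrow> f x = g x"
  shows "smooth_on S f \<longleftrightarrow> smooth_on S g"
  using assms by (simp add: smooth_on_def)

text \<open>
  Smoothness on a set is defined by extensions near each point, so pieces on a relatively open
  cover can be glued without any compatibility of the chosen extensions.
\<close>

lemma smooth_on_local:
  assumes "\<And>x. x \<in> S \<Longrightarrow> \<exists>W. open W \<and> x \<in> W \<and> smooth_on (S \<inter> W) f"
  shows "smooth_on S f"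
proof (rule smooth_onI)
  fix x assume "x \<in> S"
  with assms obtain W where W: "open W" "x \<in> W" "smooth_on (S \<inter> W) f" by metis
  with \<open>x \<in> S\<close> obtain V F where V: "open V" "x \<in> V" "\<And>k. Ck_on k V F"
    "\<And>y. y \<in> S \<inter> W \<Longrightarrow> y \<in> V \<Longrightarrow> F y = f y"
    using smooth_onE[of "S \<inter> W" f x] by blast
  show "\<exists>W F. open W \<and> x \<in> W \<and> (\<forall>k. Ck_on k W F) \<and> (\<forall>y\<in>S \<inter> W. F y = f y)"
  proof (intro exI conjI allI ballI)
    show "open (V \<inter> W)" "x \<in> V \<inter> W"
      using V W by auto
    show "Ck_on k (V \<inter> W) F" for k
      using V(3) by (rule Ck_on_subset) simp
    show "F y = f y" if "y \<in> S \<inter> (V \<inter> W)" for y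
      using V(4) that by blast
  qed
qed

lemma smooth_on_open: "open S \<Longrightarrow> (\<And>k. Ck_on k S f) \<Longrightarrow> smooth_on S f"
  by (rule smooth_onI) (intro exI[of _ S] exI[of _ f], simp)

lemma smooth_on_const: "smooth_on S (\<lambda>x. c)"
  using smooth_on_subset[OF smooth_on_open[OF open_UNIV Ck_on_const[OF open_UNIV]]] by simp

lemma smooth_on_add:
  assumes "smooth_on S f" "smooth_on S g"
  shows "smooth_on S (\<lambda>x. f x + g x)"
proof (rule smooth_onI)
  fix x assume "x \<in> S"
  obtain V F where F: "open V" "x \<in> V" "\<And>k. Ck_on k V F" "\<And>y. y \<in> S \<Longrightarrow> y \<in> V \<Longrightarrow> F y = f y"
    using smooth_onE[OF assms(1) \<open>x \<in> S\<close>] by blast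
  obtain W G where G: "open W" "x \<in> W" "\<And>k. Ck_on k W G" "\<And>y. y \<in> S \<Longrightarrow> y \<in> W \<Longrightarrow> G y = g y"
    using smooth_onE[OF assms(2) \<open>x \<in> S\<close>] by blast
  have "Ck_on k (V \<inter> W) (\<lambda>x. F x + G x)" for k
    using F G by (intro Ck_on_add) (auto intro: Ck_on_subset)
  with F G show "\<exists>W H. open W \<and> x \<in> W \<and> (\<forall>k. Ck_on k W H) \<and> (\<forall>y\<in>S \<inter> W. H y = f y + g y)"
    by (intro exI[of _ "V \<inter> W"] exI[of _ "\<lambda>x. F x + G x"]) auto
qed

lemma smooth_on_bilinear:
  assumes "bounded_bilinear pr" "smooth_on S f" "smooth_on S g"
  shows "smooth_on S (\<lambda>x. pr (f x) (g x))"
proof (rule smooth_onI)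
  fix x assume "x \<in> S"
  obtain V F where F: "open V" "x \<in> V" "\<And>k. Ck_on k V F" "\<And>y. y \<in> S \<Longrightarrow> y \<in> V \<Longrightarrow> F y = f y"
    using smooth_onE[OF assms(2) \<open>x \<in> S\<close>] by blast
  obtain W G where G: "open W" "x \<in> W" "\<And>k. Ck_on k W G" "\<And>y. y \<in> S \<Longrightarrow> y \<in> W \<Longrightarrow> G y = g y"
    using smooth_onE[OF assms(3) \<open>x \<in> S\<close>] by blast
  have "Ck_on k (V \<inter> W) (\<lambda>x. pr (F x) (G x))" for k
    using F G by (intro Ck_on_bilinear[OF assms(1)]) (auto intro: Ck_on_subset)
  with F G show "\<exists>W H. open W \<and> x \<in> W \<and> (\<forall>k. Ck_on k W H) \<and> (\<forall>y\<in>S \<inter> W. H y = pr (f y) (g y))"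
    by (intro exI[of _ "V \<inter> W"] exI[of _ "\<lambda>x. pr (F x) (G x)"]) auto
qed

lemma smooth_on_compose:
  fixes f :: "'a::euclidean_space \<Rightarrow> 'b::euclidean_space" and g :: "'b \<Rightarrow> 'c::real_normed_vector"
  assumes "smooth_on S f" "smooth_on T g" "f ` S \<subseteq> T"
  shows "smooth_on S (\<lambda>x. g (f x))"
proof (rule smooth_onI)
  fix x assume "x \<in> S"
  obtain V F where F: "open V" "x \<in> V" "\<And>k. Ck_on k V F" "\<And>y. y \<in> S \<Longrightarrow> y \<in> V \<Longrightarrow> F y = f y"
    using smooth_onE[OF assms(1) \<open>x \<in> S\<close>] by blast
  have "f x \<in> T" using \<open>x \<in> S\<close> assms(3) by auto
  obtain W G where G: "open W" "f x \<in> W" "\<And>k. Ck_on k W G" "\<And>y. y \<in> T \<Longrightarrow> y \<in> W \<Longrightarrow> G y = g y"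
    using smooth_onE[OF assms(2) \<open>f x \<in> T\<close>] by blast
  let ?U = "V \<inter> F -` W"
  have U: "open ?U"
    using F(1) G(1) Ck_on_imp_continuous[OF F(3)] by (auto simp: continuous_on_open_vimage Int_commute)
  show "\<exists>W H. open W \<and> x \<in> W \<and> (\<forall>k. Ck_on k W H) \<and> (\<forall>y\<in>S \<inter> W. H y = g (f y))"
  proof (intro exI conjI allI ballI)
    show "open ?U" by (fact U)
    show "x \<in> ?U" using F G \<open>x \<in> S\<close> by simp
    have "Ck_on k ?U F" for k
      using F(3) by (rule Ck_on_subset) simp
    then show "Ck_on k ?U (\<lambda>x. G (F x))" for k
      using G(3) by (rule Ck_on_compose[OF U G(1), rotated]) auto
    fix y assume "y \<in> S \<inter> ?U"
    then have "F y = f y" "F y \<in> W" "f y \<in> T"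
      using F(4) assms(3) by auto
    then show "G (F y) = g (f y)"
      using G(4)[of "f y"] by simp
  qed
qed

section \<open>Smooth functions on open sets of a manifold\<close>

text \<open>
  The structure on which computations in charts depend. Open submanifolds inherit it directly.
\<close>

definition charted :: "('a, 'e::euclidean_space) manifold \<Rightarrow> bool" where
  "charted M \<longleftrightarrow> (\<forall>(U, \<phi>)\<in>atlas M. chart M U \<phi>) \<and> (\<Union>(U, \<phi>)\<in>atlas M. U) = points M"

text \<open>
  The localised form of membership in \<^const>\<open>smooth_functions\<close>, with values in an arbitrary normed
  space.
\<close>

definition smooth_in ::
    "('a, 'e::euclidean_space) manifold \<Rightarrow> 'a set \<Rightarrow> ('a \<Rightarrow> 'b::real_normed_vector) \<Rightarrow> bool" where
  "smooth_in M A f \<longleftrightarrow> (\<forall>(U, \<phi>)\<in>atlas M. smooth_on (\<phi> ` (U \<inter> A)) (f \<circ> inv_into U \<phi>))"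

lemma smooth_manifold_charted: "smooth_manifold M \<Longrightarrow> charted M"
  by (simp add: smooth_manifold_def charted_def)

lemma charted_chart: "charted M \<Longrightarrow> (U, \<phi>) \<in> atlas M \<Longrightarrow> chart M U \<phi>"
  by (auto simp: charted_def)

lemma charted_cover:
  assumes "charted M" "x \<in> points M"
  obtains U \<phi> where "(U, \<phi>) \<in> atlas M" "x \<in> U"
proof -
  have "x \<in> (\<Union>(U, \<phi>)\<in>atlas M. U)"
    using assms by (simp add: charted_def)
  then show ?thesis using that by auto
qed

lemma chart_subset: "chart M U \<phi> \<Longrightarrow> U \<subseteq> points M"
  by (simp add: chart_def openin_subset)

lemma chart_inj: "chart M U \<phi> \<Longrightarrow> inj_on \<phi> U"
  using chart_subset[of M U \<phi>]
    homeomorphic_imp_injective_map[of "subtopology (mtop M) U" "top_of_set (\<phi> ` U)" \<phi>]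
  by (simp add: chart_def topspace_subtopology_subset Int_absorb1)

lemma chart_inv: "chart M U \<phi> \<Longrightarrow> x \<in> U \<Longrightarrow> inv_into U \<phi> (\<phi> x) = x"
  by (simp add: chart_inj)

text \<open>
  This is what makes \<open>smooth_on_local\<close> applicable in a chart.
\<close>

lemma chart_open_image:
  assumes "chart M U \<phi>" "openin (mtop M) A"
  obtains W where "open W" "\<And>x. x \<in> U \<Longrightarrow> \<phi> x \<in> W \<longleftrightarrow> x \<in> A"
proof -
  have "openin (subtopology (mtop M) U) (U \<inter> A)"
    using assms(2) by (simp add: openin_subtopology_Int2)
  then have "openin (top_of_set (\<phi> ` U)) (\<phi> ` (U \<inter> A))"
    using assms(1) chart_subset[OF assms(1)] homeomorphic_map_openness[of "subtopology (mtop M) U" _ \<phi> "U \<inter> A"]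
    by (auto simp: chart_def topspace_subtopology_subset)
  then obtain W where "open W" "\<phi> ` (U \<inter> A) = \<phi> ` U \<inter> W"
    by (auto simp: openin_open)
  moreover have "\<phi> x \<in> W \<longleftrightarrow> x \<in> A" if "x \<in> U" for x
  proof -
    have "\<phi> x \<in> \<phi> ` (U \<inter> A) \<longleftrightarrow> x \<in> U \<inter> A"
      using that by (intro inj_on_image_mem_iff[OF chart_inj[OF assms(1)]]) auto
    with that calculation(2) show ?thesis by auto
  qed
  ultimately show ?thesis using that by blast
qed

lemma chart_open_vimage:
  assumes "chart M U \<phi>" "open W"
  shows "openin (mtop M) {x \<in> U. \<phi> x \<in> W}"
proof -
  have "continuous_map (subtopology (mtop M) U) (top_of_set (\<phi> ` U)) \<phi>"
    using assms(1) by (auto simp: chart_def dest: homeomorphic_imp_continuous_map)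
  moreover have "openin (top_of_set (\<phi> ` U)) (\<phi> ` U \<inter> W)"
    using assms(2) by auto
  ultimately have "openin (subtopology (mtop M) U) {x \<in> topspace (subtopology (mtop M) U). \<phi> x \<in> \<phi> ` U \<inter> W}"
    by (rule openin_continuous_map_preimage)
  moreover have "{x \<in> topspace (subtopology (mtop M) U). \<phi> x \<in> \<phi> ` U \<inter> W} = {x \<in> U. \<phi> x \<in> W}"
    using chart_subset[OF assms(1)] by auto
  ultimately show ?thesis
    using assms(1) by (simp add: chart_def openin_open_subtopology)
qed

lemma smooth_inD: "smooth_in M A f \<Longrightarrow> (U, \<phi>) \<in> atlas M \<Longrightarrow> smooth_on (\<phi> ` (U \<inter> A)) (f \<circ> inv_into U \<phi>)"
  by (auto simp: smooth_in_def)

lemma smooth_in_subset: "smooth_in M A f \<Longrightarrow> B \<subseteq> A \<Longrightarrow> smooth_in M B f"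
  unfolding smooth_in_def by (fastforce intro: smooth_on_subset)

lemma smooth_in_cong:
  assumes "charted M" "\<And>x. x \<in> A \<Longrightarrow> f x = g x"
  shows "smooth_in M A f \<longleftrightarrow> smooth_in M A g"
proof -
  have "smooth_on (\<phi> ` (U \<inter> A)) (f \<circ> inv_into U \<phi>) \<longleftrightarrow> smooth_on (\<phi> ` (U \<inter> A)) (g \<circ> inv_into U \<phi>)"
    if "(U, \<phi>) \<in> atlas M" for U \<phi>
    using assms(2) chart_inv[OF charted_chart[OF assms(1) that]] by (intro smooth_on_cong) auto
  then show ?thesis by (auto simp: smooth_in_def)
qed

lemma smooth_in_local:
  assumes "charted M" "\<And>x. x \<in> A \<Longrightarrow> \<exists>B. openin (mtop M) B \<and> x \<in> B \<and> smooth_in M (A \<inter> B) f"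
  shows "smooth_in M A f"
  unfolding smooth_in_def
proof (clarify, rule smooth_on_local)
  fix U \<phi> y assume U: "(U, \<phi>) \<in> atlas M" and "y \<in> \<phi> ` (U \<inter> A)"
  then obtain x where x: "x \<in> U" "x \<in> A" "y = \<phi> x" by auto
  then obtain B where B: "openin (mtop M) B" "x \<in> B" "smooth_in M (A \<inter> B) f"
    using assms(2) by blast
  obtain W where W: "open W" "\<And>x. x \<in> U \<Longrightarrow> \<phi> x \<in> W \<longleftrightarrow> x \<in> B"
    using chart_open_image[OF charted_chart[OF assms(1) U] B(1)] by blast
  have "\<phi> ` (U \<inter> A) \<inter> W = \<phi> ` (U \<inter> (A \<inter> B))"
    using W(2) by auto
  then show "\<exists>W. open W \<and> y \<in> W \<and> smooth_on (\<phi> ` (U \<inter> A) \<inter> W) (f \<circ> inv_into U \<phi>)"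
    using W x B(2) smooth_inD[OF B(3) U] by (intro exI[of _ W]) auto
qed

lemma smooth_in_const: "smooth_in M A (\<lambda>x. c)"
  by (auto simp: smooth_in_def o_def smooth_on_const)

lemma smooth_in_add: "smooth_in M A f \<Longrightarrow> smooth_in M A g \<Longrightarrow> smooth_in M A (\<lambda>x. f x + g x)"
  by (auto simp: smooth_in_def o_def intro!: smooth_on_add)

lemma smooth_in_bilinear:
  "bounded_bilinear pr \<Longrightarrow> smooth_in M A f \<Longrightarrow> smooth_in M A g \<Longrightarrow> smooth_in M A (\<lambda>x. pr (f x) (g x))"
  by (auto simp: smooth_in_def o_def intro!: smooth_on_bilinear[where pr = pr])

lemmas smooth_in_mult = smooth_in_bilinear[OF bounded_bilinear_mult]
lemmas smooth_in_scaleR = smooth_in_bilinear[OF bounded_bilinear_scaleR]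

lemma smooth_in_linear:
  assumes "bounded_linear L" "smooth_in M A f"
  shows "smooth_in M A (\<lambda>x. L (f x))"
proof -
  have "bounded_bilinear (\<lambda>(r::real) y. r *\<^sub>R L y)"
    by (rule bounded_bilinear.comp[OF bounded_bilinear_scaleR bounded_linear_ident assms(1)])
  from smooth_in_bilinear[OF this smooth_in_const[where c = 1] assms(2)] show ?thesis by simp
qed

lemma smooth_in_sum:
  "(\<And>i. i \<in> I \<Longrightarrow> smooth_in M A (f i)) \<Longrightarrow> smooth_in M A (\<lambda>x. \<Sum>i\<in>I. f i x)"
  by (induction I rule: infinite_finite_induct) (auto intro: smooth_in_add smooth_in_const)

lemma smooth_in_prod:
  fixes f :: "'i \<Rightarrow> 'a \<Rightarrow> 'b::{real_normed_algebra, comm_ring_1}"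
  shows "(\<And>i. i \<in> I \<Longrightarrow> smooth_in M A (f i)) \<Longrightarrow> smooth_in M A (\<lambda>x. \<Prod>i\<in>I. f i x)"
  by (induction I rule: infinite_finite_induct) (auto intro: smooth_in_mult smooth_in_const)

lemma smooth_in_diff: 
  assumes "smooth_in M A f" "smooth_in M A g"
  shows "smooth_in M A (\<lambda>x. f x - g x)"
  using smooth_in_add[OF assms(1) smooth_in_linear[OF bounded_linear_minus[OF bounded_linear_ident] assms(2)]]
  by simp

lemma smooth_in_compose_on:
  fixes f :: "'a \<Rightarrow> 'b::euclidean_space"
  assumes "charted M" "smooth_in M A f" "smooth_on T g" "f ` A \<subseteq> T"
  shows "smooth_in M A (\<lambda>x. g (f x))"
  unfolding smooth_in_def
proof clarify
  fix U \<phi> assume U: "(U, \<phi>) \<in> atlas M"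
  have "(f \<circ> inv_into U \<phi>) ` \<phi> ` (U \<inter> A) \<subseteq> T"
    using chart_inv[OF charted_chart[OF assms(1) U]] assms(4) by auto
  from smooth_on_compose[OF smooth_inD[OF assms(2) U] assms(3) this]
  show "smooth_on (\<phi> ` (U \<inter> A)) ((\<lambda>x. g (f x)) \<circ> inv_into U \<phi>)"
    by (simp add: o_def)
qed

lemma smooth_in_inverse:
  fixes f :: "'a \<Rightarrow> real"
  assumes "charted M" "smooth_in M A f" "\<And>x. x \<in> A \<Longrightarrow> f x \<noteq> 0"
  shows "smooth_in M A (\<lambda>x. inverse (f x))"
  using assms(3)
  by (intro smooth_in_compose_on[OF assms(1,2) smooth_on_open[OF _ Ck_on_inverse]]) auto

text \<open>
  A function that is smooth in one chart is smooth in all others on the domain of that chart,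
  because the transition maps are smooth.
\<close>

lemma smooth_in_chart:
  assumes "smooth_manifold M" "(U, \<phi>) \<in> atlas M" "smooth_on UNIV b"
  shows "smooth_in M U (\<lambda>x. b (\<phi> x))"
  unfolding smooth_in_def
proof clarify
  fix V \<psi> assume "(V, \<psi>) \<in> atlas M"
  with assms(1,2) have "smooth_on (\<psi> ` (V \<inter> U)) (\<phi> \<circ> inv_into V \<psi>)"
    by (auto simp: smooth_manifold_def)
  from smooth_on_compose[OF this assms(3)] show "smooth_on (\<psi> ` (V \<inter> U)) ((\<lambda>x. b (\<phi> x)) \<circ> inv_into V \<psi>)"
    by (simp add: o_def)
qed

lemma smooth_map_points: "smooth_map M N F \<Longrightarrow> x \<in> points M \<Longrightarrow> F x \<in> points N"
  by (auto simp: smooth_map_def dest: continuous_map_image_subset_topspace)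

text \<open>
  Near each point, factor the composition through a chart of the target around the image point.
\<close>

lemma smooth_in_pullback:
  assumes "charted N" "charted M" "smooth_map N M F" "openin (mtop M) A" "smooth_in M A f"
    and "B \<subseteq> points N" "F ` B \<subseteq> A"
  shows "smooth_in N B (\<lambda>x. f (F x))"
  unfolding smooth_in_def
proof (clarify, rule smooth_on_local)
  fix U \<phi> y assume U: "(U, \<phi>) \<in> atlas N" and "y \<in> \<phi> ` (U \<inter> B)"
  then obtain x where x: "x \<in> U" "x \<in> B" "y = \<phi> x" by auto
  have "F x \<in> points M"
    using x(2) assms(4,7) openin_subset by blast
  then obtain V \<psi> where V: "(V, \<psi>) \<in> atlas M" "F x \<in> V"
    using charted_cover[OF assms(2)] by blast
  note N = charted_chart[OF assms(1) U] and M = charted_chart[OF assms(2) V(1)]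
  have "openin (mtop N) {x \<in> points N. F x \<in> V}"
    using assms(3) M by (auto simp: smooth_map_def chart_def intro: openin_continuous_map_preimage)
  from chart_open_image[OF N this] obtain W where
    W0: "open W" "\<And>x. x \<in> U \<Longrightarrow> \<phi> x \<in> W \<longleftrightarrow> x \<in> {x \<in> points N. F x \<in> V}"
    by blast
  then have W: "open W" "\<And>x. x \<in> U \<Longrightarrow> \<phi> x \<in> W \<longleftrightarrow> F x \<in> V"
    using chart_subset[OF N] by auto
  have 1: "smooth_on (\<phi> ` {x \<in> U. F x \<in> V}) (\<psi> \<circ> F \<circ> inv_into U \<phi>)"
    using assms(3) U V(1) by (auto simp: smooth_map_def)
  have "smooth_on (\<phi> ` (U \<inter> B) \<inter> W) (\<psi> \<circ> F \<circ> inv_into U \<phi>)"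
    using W(2) by (intro smooth_on_subset[OF 1]) auto
  moreover have "(\<psi> \<circ> F \<circ> inv_into U \<phi>) ` (\<phi> ` (U \<inter> B) \<inter> W) \<subseteq> \<psi> ` (V \<inter> A)"
    using chart_inv[OF N] W(2) assms(7) by auto
  ultimately have "smooth_on (\<phi> ` (U \<inter> B) \<inter> W)
      (\<lambda>y. (f \<circ> inv_into V \<psi>) ((\<psi> \<circ> F \<circ> inv_into U \<phi>) y))"
    by (rule smooth_on_compose[OF _ smooth_inD[OF assms(5) V(1)]])
  moreover have "(f \<circ> inv_into V \<psi>) ((\<psi> \<circ> F \<circ> inv_into U \<phi>) y) = ((\<lambda>x. f (F x)) \<circ> inv_into U \<phi>) y"
    if "y \<in> \<phi> ` (U \<inter> B) \<inter> W" for y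
    using that chart_inv[OF N] chart_inv[OF M] W(2) by auto
  ultimately have "smooth_on (\<phi> ` (U \<inter> B) \<inter> W) ((\<lambda>x. f (F x)) \<circ> inv_into U \<phi>)"
    by (subst (asm) smooth_on_cong) auto
  then show "\<exists>W. open W \<and> y \<in> W \<and> smooth_on (\<phi> ` (U \<inter> B) \<inter> W) ((\<lambda>x. f (F x)) \<circ> inv_into U \<phi>)"
    using W V(2) x by (intro exI[of _ W]) auto
qed

section \<open>Open submanifolds and slices of products\<close>

lemma chart_open_submanifold:
  assumes "chart M U \<phi>" "openin (mtop M) W"
  shows "chart (open_submanifold M W) (U \<inter> W) \<phi>"
proof -
  have U: "openin (mtop M) U" and mod: "openin (top_of_set (model M)) (\<phi> ` U)"
    and hom: "homeomorphic_map (subtopology (mtop M) U) (top_of_set (\<phi> ` U)) \<phi>"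
    using assms(1) by (auto simp: chart_def)
  have top: "topspace (subtopology (mtop M) U) = U"
    using chart_subset[OF assms(1)] by auto
  have "openin (subtopology (mtop M) U) (U \<inter> W)"
    using assms(2) by (simp add: openin_subtopology_Int2)
  then have "openin (top_of_set (\<phi> ` U)) (\<phi> ` (U \<inter> W))"
    using homeomorphic_map_openness[OF hom, of "U \<inter> W"] top by auto
  with mod have "openin (top_of_set (model M)) (\<phi> ` (U \<inter> W))"
    by (rule openin_trans[rotated])
  moreover have "homeomorphic_map (subtopology (subtopology (mtop M) U) W)
      (subtopology (top_of_set (\<phi> ` U)) (\<phi> ` (U \<inter> W))) \<phi>"
    by (rule homeomorphic_map_subtopologies[OF hom]) (use top in auto)
  moreover have "\<phi> ` U \<inter> \<phi> ` (U \<inter> W) = \<phi> ` (U \<inter> W)"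
    by auto
  moreover have "openin (subtopology (mtop M) W) (U \<inter> W)"
    using U by (auto simp: openin_subtopology)
  ultimately show ?thesis
    by (simp add: chart_def open_submanifold_def subtopology_subtopology Int_ac)
qed

lemma charted_open_submanifold:
  assumes "charted M" "openin (mtop M) W"
  shows "charted (open_submanifold M W)"
proof -
  have "\<forall>(U, \<phi>)\<in>atlas (open_submanifold M W). chart (open_submanifold M W) U \<phi>"
    using chart_open_submanifold[OF charted_chart[OF assms(1)] assms(2)]
    by (auto simp: open_submanifold_def)
  moreover have "(\<Union>(U, \<phi>)\<in>atlas (open_submanifold M W). U) = (\<Union>(U, \<phi>)\<in>atlas M. U) \<inter> W"
    by (auto simp: open_submanifold_def)
  ultimately show ?thesis
    using assms(1) by (simp add: charted_def open_submanifold_def)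
qed

lemma smooth_in_open_submanifold:
  assumes "charted M"
  shows "smooth_in (open_submanifold M W) A f \<longleftrightarrow> smooth_in M (W \<inter> A) f"
proof -
  have "smooth_on (\<phi> ` (U \<inter> W \<inter> A)) (f \<circ> inv_into (U \<inter> W) \<phi>) \<longleftrightarrow>
        smooth_on (\<phi> ` (U \<inter> (W \<inter> A))) (f \<circ> inv_into U \<phi>)" if "(U, \<phi>) \<in> atlas M" for U \<phi>
  proof -
    note ch = charted_chart[OF assms that]
    have "inv_into (U \<inter> W) \<phi> (\<phi> x) = x" if "x \<in> U" "x \<in> W" for x
      using that inj_on_subset[OF chart_inj[OF ch], of "U \<inter> W"] by (intro inv_into_f_f) auto
    then have "smooth_on (\<phi> ` (U \<inter> W \<inter> A)) (f \<circ> inv_into (U \<inter> W) \<phi>) \<longleftrightarrow>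
        smooth_on (\<phi> ` (U \<inter> W \<inter> A)) (f \<circ> inv_into U \<phi>)"
      using chart_inv[OF ch] by (intro smooth_on_cong) auto
    then show ?thesis by (simp add: Int_assoc)
  qed
  then show ?thesis
    by (auto simp: smooth_in_def open_submanifold_def)
qed

lemma smooth_on_Pair_const:
  fixes c :: "'b::euclidean_space"
  shows "smooth_on S (\<lambda>x::'a::euclidean_space. (x, c))"
proof -
  have "bounded_linear (\<lambda>x::'a. (x, 0::'b))"
    by (intro bounded_linear_Pair bounded_linear_ident bounded_linear_zero)
  then have "smooth_on UNIV (\<lambda>x::'a. (x, 0::'b))"
    by (intro smooth_on_open Ck_on_linear[where L = "\<lambda>x. (x, 0)"] Ck_on_id) auto
  from smooth_on_add[OF this smooth_on_const[where c = "(0, c)"]]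
  have "smooth_on UNIV (\<lambda>x::'a. (x, c))" by simp
  then show ?thesis by (rule smooth_on_subset) simp
qed

text \<open>
  In a product chart the inclusion \<open>x \<mapsto> (x, c)\<close> is affine. This makes smooth both the translation
  by a group element and a single sheet of a local trivialization.
\<close>

lemma smooth_map_slice:
  assumes "charted M" "charted N" "smooth_map (prod_manifold M N) Q f" "c \<in> points N"
  shows "smooth_map M Q (\<lambda>x. f (x, c))"
  unfolding smooth_map_def
proof (intro conjI)
  have "continuous_map (mtop M) (prod_topology (mtop M) (mtop N)) (\<lambda>x. (x, c))"
    using assms(4) by (intro continuous_map_pairedI) auto
  moreover have "continuous_map (prod_topology (mtop M) (mtop N)) (mtop Q) f"
    using assms(3) by (simp add: smooth_map_def prod_manifold_def)
  ultimately show "continuous_map (mtop M) (mtop Q) (\<lambda>x. f (x, c))"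
    using continuous_map_compose by (fastforce simp: o_def)
  obtain B \<beta> where B: "(B, \<beta>) \<in> atlas N" "c \<in> B"
    using charted_cover[OF assms(2,4)] by blast
  show "\<forall>(U, \<phi>)\<in>atlas M. \<forall>(V, \<psi>)\<in>atlas Q.
      smooth_on (\<phi> ` {x \<in> U. f (x, c) \<in> V}) (\<psi> \<circ> (\<lambda>x. f (x, c)) \<circ> inv_into U \<phi>)"
  proof clarify
    fix U \<phi> V \<psi> assume U: "(U, \<phi>) \<in> atlas M" and V: "(V, \<psi>) \<in> atlas Q"
    let ?\<pi> = "map_prod \<phi> \<beta>"
    have "(U \<times> B, ?\<pi>) \<in> atlas (prod_manifold M N)"
      using U B by (auto simp: prod_manifold_def)
    with assms(3) V have "smooth_on (?\<pi> ` {z \<in> U \<times> B. f z \<in> V}) (\<psi> \<circ> f \<circ> inv_into (U \<times> B) ?\<pi>)"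
      by (fastforce simp: smooth_map_def)
    moreover have "(\<lambda>y. (y, \<beta> c)) ` \<phi> ` {x \<in> U. f (x, c) \<in> V} \<subseteq> ?\<pi> ` {z \<in> U \<times> B. f z \<in> V}"
      using B(2) by (force simp: image_iff)
    ultimately have "smooth_on (\<phi> ` {x \<in> U. f (x, c) \<in> V})
        (\<lambda>y. (\<psi> \<circ> f \<circ> inv_into (U \<times> B) ?\<pi>) (y, \<beta> c))"
      by (rule smooth_on_compose[OF smooth_on_Pair_const])
    moreover have "inv_into (U \<times> B) ?\<pi> (\<phi> x, \<beta> c) = (x, c)" if "x \<in> U" for x
      using that B(2) map_prod_inj_on[OF chart_inj[OF charted_chart[OF assms(1) U]]
          chart_inj[OF charted_chart[OF assms(2) B(1)]]]
        inv_into_f_f[of ?\<pi> "U \<times> B" "(x, c)"] by simp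
    ultimately show "smooth_on (\<phi> ` {x \<in> U. f (x, c) \<in> V}) (\<psi> \<circ> (\<lambda>x. f (x, c)) \<circ> inv_into U \<phi>)"
      using chart_inv[OF charted_chart[OF assms(1) U]] by (subst (asm) smooth_on_cong) auto
  qed
qed

section \<open>Bump functions\<close>

text \<open>
  With \<open>flat t = exp (-1/t)\<close> for positive \<open>t\<close> and 0 otherwise, the quotient \<open>flat t / (flat t + flat
  (1 - t))\<close> has a positive denominator everywhere and the two required plateaus.
\<close>

lemma smooth_step:
  obtains h :: "real \<Rightarrow> real"
  where "smooth_on UNIV h" "\<And>t. t \<le> 0 \<Longrightarrow> h t = 0" "\<And>t. 1 \<le> t \<Longrightarrow> h t = 1"
proof -
  define flat where "flat = (\<lambda>t::real. if 0 < t then exp (- inverse t) else 0)"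
  have flat: "smooth_on UNIV flat"
    using Ck_on_flat_poly[of _ "[:1:]"] by (intro smooth_on_open) (simp_all add: flat_def cong: if_cong)
  have "smooth_on UNIV (\<lambda>t::real. 1 + (- 1) * t)"
    by (intro smooth_on_add smooth_on_const smooth_on_bilinear[OF bounded_bilinear_mult]
        smooth_on_open Ck_on_id) auto
  from smooth_on_compose[OF this flat] have "smooth_on UNIV (\<lambda>t. flat (1 - t))"
    by simp
  from smooth_on_add[OF flat this] have den: "smooth_on UNIV (\<lambda>t. flat t + flat (1 - t))" .
  have "flat t + flat (1 - t) > 0" for t
    by (auto simp: flat_def add_pos_pos)
  then have "smooth_on UNIV (\<lambda>t. inverse (flat t + flat (1 - t)))"
    by (intro smooth_on_compose[OF den smooth_on_open[OF _ Ck_on_inverse]]) (auto simp: less_le)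
  from smooth_on_bilinear[OF bounded_bilinear_mult flat this]
  have "smooth_on UNIV (\<lambda>t. flat t * inverse (flat t + flat (1 - t)))" .
  then show ?thesis
    by (rule that) (auto simp: flat_def)
qed

lemma euclidean_bump:
  fixes c :: "'a::euclidean_space"
  assumes "0 < r"
  obtains b :: "'a \<Rightarrow> real"
  where "smooth_on UNIV b" "\<And>x. dist c x \<le> r \<Longrightarrow> b x = 1" "\<And>x. 2 * r \<le> dist c x \<Longrightarrow> b x = 0"
proof -
  obtain h :: "real \<Rightarrow> real" where h: "smooth_on UNIV h" "\<And>t. t \<le> 0 \<Longrightarrow> h t = 0" "\<And>t. 1 \<le> t \<Longrightarrow> h t = 1"
    using smooth_step by blast
  define b where "b = (\<lambda>x. h (2 - (dist c x / r)\<^sup>2))"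
  have d: "smooth_on UNIV (\<lambda>x. x + - c)"
    by (intro smooth_on_add smooth_on_const smooth_on_open Ck_on_id) auto
  have "smooth_on UNIV (\<lambda>x. 2 + (- 1 / r\<^sup>2) * ((x + - c) \<bullet> (x + - c)))"
    by (intro smooth_on_add smooth_on_const smooth_on_bilinear[OF bounded_bilinear_mult]
        smooth_on_bilinear[OF bounded_bilinear_inner d d])
  moreover have "2 + (- 1 / r\<^sup>2) * ((x + - c) \<bullet> (x + - c)) = 2 - (dist c x / r)\<^sup>2" for x
    by (simp add: dist_norm norm_minus_commute power_divide flip: power2_norm_eq_inner)
  ultimately have "smooth_on UNIV (\<lambda>x. 2 - (dist c x / r)\<^sup>2)" by simp
  from smooth_on_compose[OF this h(1)] have "smooth_on UNIV b"
    by (simp add: b_def)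
  moreover have "b x = 1" if "dist c x \<le> r" for x
  proof -
    have "(dist c x / r)\<^sup>2 \<le> 1"
      using that assms by (intro power_le_one) auto
    then show ?thesis by (simp add: b_def h(3))
  qed
  moreover have "b x = 0" if "2 * r \<le> dist c x" for x
  proof -
    have "2\<^sup>2 \<le> (dist c x / r)\<^sup>2"
      using that assms by (intro power_mono) (auto simp: field_simps)
    then show ?thesis by (simp add: b_def h(2))
  qed
  ultimately show ?thesis using that by blast
qed

lemma manifold_bump:
  fixes M :: "('a, 'e::euclidean_space) manifold"
  assumes "smooth_manifold M" "openin (mtop M) A" "p \<in> A"
  obtains \<rho> :: "'a \<Rightarrow> real" and B
  where "smooth_in M (points M) \<rho>" "\<And>x. x \<in> points M \<Longrightarrow> x \<notin> A \<Longrightarrow> \<rho> x = 0"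
    "openin (mtop M) B" "p \<in> B" "\<And>x. x \<in> B \<Longrightarrow> \<rho> x = 1"
proof -
  note cM = smooth_manifold_charted[OF assms(1)]
  have "p \<in> points M"
    using assms(2,3) openin_subset by blast
  then obtain U \<phi> where U: "(U, \<phi>) \<in> atlas M" "p \<in> U"
    using charted_cover[OF cM] by blast
  note ch = charted_chart[OF cM U(1)]
  have hom: "homeomorphic_map (subtopology (mtop M) U) (top_of_set (\<phi> ` U)) \<phi>"
    and "openin (mtop M) U"
    using ch by (auto simp: chart_def)
  obtain W where W: "open W" "\<And>x. x \<in> U \<Longrightarrow> \<phi> x \<in> W \<longleftrightarrow> x \<in> A"
    using chart_open_image[OF ch assms(2)] by blast
  obtain T where T: "open T" "\<phi> ` U = model M \<inter> T"
    using ch by (auto simp: chart_def openin_open)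
  have "open (W \<inter> T)" "\<phi> p \<in> W \<inter> T"
    using W T U(2) assms(3) by auto
  then obtain s where s: "0 < s" "cball (\<phi> p) s \<subseteq> W \<inter> T"
    by (meson open_contains_cball)
  obtain b where b: "smooth_on UNIV b" "\<And>x. dist (\<phi> p) x \<le> s / 2 \<Longrightarrow> b x = (1::real)"
    "\<And>x. 2 * (s / 2) \<le> dist (\<phi> p) x \<Longrightarrow> b x = 0"
    using euclidean_bump[of "s / 2" "\<phi> p"] s(1) by auto
  define \<rho> where "\<rho> = (\<lambda>x. if x \<in> U then b (\<phi> x) else 0)"
  define K where "K = {x \<in> U. \<phi> x \<in> cball (\<phi> p) s}"
  \<comment> \<open>Outside the chart, smoothness comes from the support being closed, by the Hausdorff axiom.\<close>
  have "closedin (mtop M) K"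
  proof -
    have "compact (model M \<inter> cball (\<phi> p) s)"
      using assms(1) by (intro closed_Int_compact closed_subspace) (auto simp: smooth_manifold_def)
    moreover have "\<phi> ` K = \<phi> ` U \<inter> cball (\<phi> p) s"
      by (auto simp: K_def)
    then have "\<phi> ` K = model M \<inter> cball (\<phi> p) s"
      using T(2) s(2) by blast
    ultimately have "compactin (top_of_set (\<phi> ` U)) (\<phi> ` K)"
      by (auto simp: compactin_subtopology K_def)
    then have "compactin (subtopology (mtop M) U) K"
      using homeomorphic_map_compactness[OF hom, of K] chart_subset[OF ch] by (auto simp: K_def)
    then show ?thesis
      using assms(1) by (auto simp: compactin_subtopology smooth_manifold_def intro: compactin_imp_closedin)
  qed
  then have K: "openin (mtop M) (points M - K)" by blast
  have "smooth_in M (points M) \<rho>"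
  proof (rule smooth_in_local[OF cM])
    fix x assume "x \<in> points M"
    show "\<exists>B. openin (mtop M) B \<and> x \<in> B \<and> smooth_in M (points M \<inter> B) \<rho>"
    proof (cases "x \<in> U")
      case True
      have "smooth_in M U \<rho>"
        using smooth_in_chart[OF assms(1) U(1) b(1)]
        by (subst smooth_in_cong[OF cM, where g = "\<lambda>x. b (\<phi> x)"]) (auto simp: \<rho>_def)
      then show ?thesis
        using True \<open>openin (mtop M) U\<close> smooth_in_subset[of M U \<rho> "points M \<inter> U"] by auto
    next
      case False
      have "smooth_in M (points M \<inter> (points M - K)) \<rho>"
        using smooth_in_const[of M _ 0] b(3)
        by (subst smooth_in_cong[OF cM, where g = "\<lambda>x. 0"]) (auto simp: \<rho>_def K_def)
      then show ?thesis
        using False \<open>x \<in> points M\<close> K by (intro exI[of _ "points M - K"]) (auto simp: K_def)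
    qed
  qed
  moreover have "\<rho> x = 0" if "x \<in> points M" "x \<notin> A" for x
  proof (cases "x \<in> U")
    case True
    with that W s(2) have "\<phi> x \<notin> cball (\<phi> p) s" by blast
    with b(3) show ?thesis by (simp add: \<rho>_def)
  qed (simp add: \<rho>_def)
  moreover have "openin (mtop M) {x \<in> U. \<phi> x \<in> ball (\<phi> p) (s / 2)}"
    by (rule chart_open_vimage[OF ch]) simp
  moreover have "p \<in> {x \<in> U. \<phi> x \<in> ball (\<phi> p) (s / 2)}"
    using U(2) s(1) by simp
  moreover have "\<rho> x = 1" if "x \<in> {x \<in> U. \<phi> x \<in> ball (\<phi> p) (s / 2)}" for x
    using that b(2) by (auto simp: \<rho>_def)
  ultimately show ?thesis using that by blast
qed

text \<open>
  The Lindelof property yields countably many bumps \<open>\<rho>\<^sub>k\<close>, each equal to 1 on an open set \<open>B\<^sub>k\<close>, such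
  that the \<open>B\<^sub>k\<close> cover the manifold. The products \<open>\<psi>\<^sub>k = \<rho>\<^sub>k \<Prod>\<^bsub>j<k\<^esub> (1 - \<rho>\<^sub>j)\<close> vanish on \<open>B\<^sub>j\<close> for \<open>j < k\<close>,
  which makes them locally finite without any refinement of the cover.
\<close>

lemma locally_finite_bumps:
  fixes M :: "('a, 'e::euclidean_space) manifold"
  assumes "smooth_manifold M" "\<And>A. A \<in> \<A> \<Longrightarrow> openin (mtop M) A" "points M \<subseteq> \<Union>\<A>" "\<A> \<noteq> {}"
  obtains \<psi> :: "nat \<Rightarrow> 'a \<Rightarrow> real"
  where "\<And>k. smooth_in M (points M) (\<psi> k)"
    "\<And>x. x \<in> points M \<Longrightarrow> \<exists>k. \<psi> k x \<noteq> 0"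
    "\<And>k. \<exists>A\<in>\<A>. {x \<in> points M. \<psi> k x \<noteq> 0} \<subseteq> A"
    "\<And>x. x \<in> points M \<Longrightarrow> \<exists>B k. openin (mtop M) B \<and> x \<in> B \<and> (\<forall>j\<ge>k. \<forall>y\<in>B. \<psi> j y = 0)"
proof -
  define good where "good = (\<lambda>B \<rho>. openin (mtop M) B \<and> smooth_in M (points M) (\<rho> :: 'a \<Rightarrow> real) \<and>
      (\<exists>A\<in>\<A>. {x \<in> points M. \<rho> x \<noteq> 0} \<subseteq> A) \<and> (\<forall>x\<in>B. \<rho> x = 1))"
  define \<B> where "\<B> = {B. \<exists>\<rho>. good B \<rho>}"
  have "points M \<subseteq> \<Union>\<B>"
  proof
    fix p assume "p \<in> points M"
    with assms(3) obtain A where A: "A \<in> \<A>" "p \<in> A" by blast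
    obtain \<rho> :: "'a \<Rightarrow> real" and B where \<rho>: "smooth_in M (points M) \<rho>"
      "\<And>x. x \<in> points M \<Longrightarrow> x \<notin> A \<Longrightarrow> \<rho> x = 0"
      "openin (mtop M) B" "p \<in> B" "\<And>x. x \<in> B \<Longrightarrow> \<rho> x = 1"
      using manifold_bump[OF assms(1) assms(2)[OF A(1)] A(2)] by blast
    then have "good B \<rho>"
      using A(1) unfolding good_def by blast
    with \<rho>(4) show "p \<in> \<Union>\<B>" by (auto simp: \<B>_def)
  qed
  moreover have "Lindelof_space (mtop M)"
    using assms(1) by (auto simp: smooth_manifold_def intro: second_countable_imp_Lindelof_space)
  moreover have "\<forall>B\<in>\<B>. openin (mtop M) B"
    by (auto simp: \<B>_def good_def)
  ultimately obtain \<V> where \<V>: "countable \<V>" "\<V> \<subseteq> \<B>" "points M \<subseteq> \<Union>\<V>"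
    unfolding Lindelof_space_alt by meson
  \<comment> \<open>The empty set keeps the enumeration meaningful if the subcover is empty.\<close>
  have "good {} (\<lambda>x. 0)"
    using assms(4) by (auto simp: good_def smooth_in_const)
  define B where "B = from_nat_into (insert {} \<V>)"
  have rB: "range B = insert {} \<V>"
    using \<V>(1) by (simp add: B_def)
  have "\<exists>\<rho>. good (B k) \<rho>" for k
  proof -
    have "B k \<in> insert {} \<V>" using rB by blast
    with \<V>(2) \<open>good {} _\<close> show ?thesis by (auto simp: \<B>_def)
  qed
  then obtain \<rho> where "\<forall>k. good (B k) (\<rho> k)" by metis
  then have \<rho>: "openin (mtop M) (B k)" "smooth_in M (points M) (\<rho> k)"
      "\<exists>A\<in>\<A>. {x \<in> points M. \<rho> k x \<noteq> 0} \<subseteq> A" "\<And>x. x \<in> B k \<Longrightarrow> \<rho> k x = 1" for k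
    by (auto simp: good_def)
  have cov: "\<exists>k. x \<in> B k" if "x \<in> points M" for x
    using that \<V>(3) rB by (metis UnionE imageE insertCI subsetD)
  define \<psi> where "\<psi> = (\<lambda>k x. \<rho> k x * (\<Prod>j<k. 1 - \<rho> j x))"
  show ?thesis
  proof (rule that)
    show "smooth_in M (points M) (\<psi> k)" for k
      unfolding \<psi>_def by (intro smooth_in_mult smooth_in_prod smooth_in_diff smooth_in_const \<rho>(2))
    show "\<exists>k. \<psi> k x \<noteq> 0" if "x \<in> points M" for x
    proof -
      obtain k where "\<rho> k x \<noteq> 0"
        using cov[OF \<open>x \<in> points M\<close>] \<rho>(4) by (metis zero_neq_one)
      \<comment> \<open>At the first index where a bump does not vanish, all earlier factors are 1.\<close>
      define l where "l = (LEAST k. \<rho> k x \<noteq> 0)"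
      have "\<rho> l x \<noteq> 0"
        unfolding l_def by (rule LeastI) fact
      moreover have "\<rho> j x = 0" if "j < l" for j
        using not_less_Least[of j "\<lambda>k. \<rho> k x \<noteq> 0"] that by (auto simp: l_def)
      ultimately have "\<psi> l x \<noteq> 0" by (simp add: \<psi>_def)
      then show ?thesis ..
    qed
    show "\<exists>A\<in>\<A>. {x \<in> points M. \<psi> k x \<noteq> 0} \<subseteq> A" for k
    proof -
      have "{x \<in> points M. \<psi> k x \<noteq> 0} \<subseteq> {x \<in> points M. \<rho> k x \<noteq> 0}"
        by (auto simp: \<psi>_def)
      then show ?thesis using \<rho>(3)[of k] by (meson order_trans)
    qed
    show "\<exists>B k. openin (mtop M) B \<and> x \<in> B \<and> (\<forall>j\<ge>k. \<forall>y\<in>B. \<psi> j y = 0)" if "x \<in> points M" for x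
    proof -
      obtain k where "x \<in> B k" using cov[OF \<open>x \<in> points M\<close>] by blast
      moreover have "\<psi> j y = 0" if "Suc k \<le> j" "y \<in> B k" for j y
        using that \<rho>(4) by (auto simp: \<psi>_def intro!: bexI[of _ k])
      ultimately show ?thesis using \<rho>(1) by blast
    qed
  qed
qed

section \<open>Generic maps into Euclidean space\<close>

text \<open>
  Locally this is the fact that a differentiable map into a space of higher dimension has a null
  image. Countably many charts suffice by second countability.
\<close>

lemma negligible_smooth_image:
  fixes M :: "('a, 'e::euclidean_space) manifold" and u :: "'a \<Rightarrow> 'n::euclidean_space"
  assumes "smooth_manifold M" "DIM('e) < DIM('n)" "smooth_in M A u" "A \<subseteq> points M"
  shows "negligible (u ` A)"
proof -
  note cM = smooth_manifold_charted[OF assms(1)]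
  define \<B> where "\<B> = {B. openin (subtopology (mtop M) A) B \<and> negligible (u ` B)}"
  have "topspace (subtopology (mtop M) A) \<subseteq> \<Union>\<B>"
  proof
    fix p assume "p \<in> topspace (subtopology (mtop M) A)"
    then have "p \<in> A" "p \<in> points M" by auto
    then obtain U \<phi> where U: "(U, \<phi>) \<in> atlas M" "p \<in> U"
      using charted_cover[OF cM] by blast
    note ch = charted_chart[OF cM U(1)]
    have "\<phi> p \<in> \<phi> ` (U \<inter> A)" using U(2) \<open>p \<in> A\<close> by blast
    then obtain W F where W: "open W" "\<phi> p \<in> W" "\<And>k. Ck_on k W F"
      "\<And>y. y \<in> \<phi> ` (U \<inter> A) \<Longrightarrow> y \<in> W \<Longrightarrow> F y = (u \<circ> inv_into U \<phi>) y"
      using smooth_onE[OF smooth_inD[OF assms(3) U(1)]] by blast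
    let ?B = "{x \<in> U. \<phi> x \<in> W} \<inter> A"
    have "F differentiable_on W"
      using W(3)[of 1] by (intro differentiable_at_imp_differentiable_on) auto
    then have "negligible (F ` W)"
      by (rule negligible_differentiable_image_lowdim[OF assms(2)])
    moreover have "u ` ?B \<subseteq> F ` W"
    proof clarify
      fix x assume "x \<in> U" "\<phi> x \<in> W" "x \<in> A"
      then have "F (\<phi> x) = u x"
        using W(4)[of "\<phi> x"] chart_inv[OF ch] by auto
      then show "u x \<in> F ` W" using \<open>\<phi> x \<in> W\<close> by (metis imageI)
    qed
    ultimately have "negligible (u ` ?B)"
      using negligible_subset by blast
    moreover have "openin (subtopology (mtop M) A) ?B"
      using chart_open_vimage[OF ch W(1)] by (auto simp: openin_subtopology)
    ultimately have "?B \<in> \<B>" by (simp add: \<B>_def)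
    then show "p \<in> \<Union>\<B>"
      using U(2) W(2) \<open>p \<in> A\<close> by blast
  qed
  moreover have "Lindelof_space (subtopology (mtop M) A)"
    using assms(1) by (auto simp: smooth_manifold_def
        intro: second_countable_imp_Lindelof_space second_countable_subtopology)
  moreover have "\<forall>B\<in>\<B>. openin (subtopology (mtop M) A) B"
    by (simp add: \<B>_def)
  ultimately obtain \<V> where \<V>: "countable \<V>" "\<V> \<subseteq> \<B>" "topspace (subtopology (mtop M) A) \<subseteq> \<Union>\<V>"
    unfolding Lindelof_space_alt by meson
  have "negligible (\<Union>((`) u ` \<V>))"
    using \<V>(1,2) by (intro negligible_countable_Union) (auto simp: \<B>_def)
  moreover have "u ` A \<subseteq> \<Union>((`) u ` \<V>)"
    using \<V>(3) assms(4) by fastforce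
  ultimately show ?thesis by (rule negligible_subset)
qed

text \<open>
  A coincidence \<open>F p + \<psi> p v = F (\<tau> p) + \<psi> (\<tau> p) v\<close> with \<open>\<psi> p \<noteq> \<psi> (\<tau> p)\<close> determines \<open>v = (F p - F (\<tau>
  p)) / (\<psi> (\<tau> p) - \<psi> p)\<close> as a smooth function of \<open>p\<close>. These exceptional vectors form a null set, so
  some \<open>v\<close> lies outside of it; then only coincidences survive that were there before and are
  invisible to \<open>\<psi>\<close>.
\<close>

lemma generic_step:
  fixes M :: "('a, 'e::euclidean_space) manifold" and F :: "'a \<Rightarrow> 'n::euclidean_space"
    and \<psi> :: "'a \<Rightarrow> real"
  assumes "smooth_manifold M" "DIM('e) < DIM('n)" "finite T" "\<And>\<tau>. \<tau> \<in> T \<Longrightarrow> smooth_map M M \<tau>"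
    and "smooth_in M (points M) F" "smooth_in M (points M) \<psi>"
  obtains v where "\<And>\<tau> p. \<tau> \<in> T \<Longrightarrow> p \<in> points M \<Longrightarrow>
      F p + \<psi> p *\<^sub>R v = F (\<tau> p) + \<psi> (\<tau> p) *\<^sub>R v \<Longrightarrow> F p = F (\<tau> p) \<and> \<psi> p = \<psi> (\<tau> p)"
proof -
  note cM = smooth_manifold_charted[OF assms(1)]
  define A where "A = (\<lambda>\<tau>. {p \<in> points M. \<psi> (\<tau> p) - \<psi> p \<noteq> 0})"
  define u where "u = (\<lambda>\<tau> p. inverse (\<psi> (\<tau> p) - \<psi> p) *\<^sub>R (F p - F (\<tau> p)))"
  have "negligible (\<Union>\<tau>\<in>T. u \<tau> ` A \<tau>)"
  proof (intro negligible_countable_Union; clarsimp?)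
    show "countable ((\<lambda>\<tau>. u \<tau> ` A \<tau>) ` T)"
      using assms(3) by (intro countable_finite) simp
    fix \<tau> assume "\<tau> \<in> T"
    note \<tau> = assms(4)[OF this]
    have "\<tau> ` points M \<subseteq> points M"
      using smooth_map_points[OF \<tau>] by blast
    then have "smooth_in M (points M) (\<lambda>x. F (\<tau> x))" "smooth_in M (points M) (\<lambda>x. \<psi> (\<tau> x))"
      using smooth_in_pullback[OF cM cM \<tau> openin_topspace assms(5)]
        smooth_in_pullback[OF cM cM \<tau> openin_topspace assms(6)] by auto
    then have "smooth_in M (A \<tau>) (\<lambda>p. \<psi> (\<tau> p) - \<psi> p)" "smooth_in M (A \<tau>) (\<lambda>p. F p - F (\<tau> p))"
      using assms(5,6) by (auto intro!: smooth_in_diff intro: smooth_in_subset simp: A_def)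
    then have "smooth_in M (A \<tau>) (u \<tau>)"
      unfolding u_def by (intro smooth_in_scaleR smooth_in_inverse[OF cM]) (auto simp: A_def)
    then show "negligible (u \<tau> ` A \<tau>)"
      by (rule negligible_smooth_image[OF assms(1,2)]) (auto simp: A_def)
  qed
  then obtain v where v: "v \<notin> (\<Union>\<tau>\<in>T. u \<tau> ` A \<tau>)"
    using non_negligible_UNIV by (metis UNIV_eq_I)
  show ?thesis
  proof (rule that)
    fix \<tau> p assume \<tau>: "\<tau> \<in> T" and p: "p \<in> points M"
      and eq: "F p + \<psi> p *\<^sub>R v = F (\<tau> p) + \<psi> (\<tau> p) *\<^sub>R v"
    have "\<psi> p = \<psi> (\<tau> p)"
    proof (rule ccontr)
      assume ne: "\<psi> p \<noteq> \<psi> (\<tau> p)"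
      have "F p - F (\<tau> p) = (\<psi> (\<tau> p) - \<psi> p) *\<^sub>R v"
        using eq by (simp add: algebra_simps)
      with ne have "v = u \<tau> p" by (simp add: u_def)
      moreover have "p \<in> A \<tau>" using p ne by (simp add: A_def)
      ultimately show False using v \<tau> by blast
    qed
    with eq show "F p = F (\<tau> p) \<and> \<psi> p = \<psi> (\<tau> p)" by simp
  qed
qed

text \<open>
  The map is the locally finite sum of the \<open>\<psi>\<^sub>k v\<^sub>k\<close>, where \<open>v\<^sub>k\<close> is chosen by the preceding lemma
  after all earlier ones. A coincidence of the sum at \<open>p\<close> and \<open>\<tau> p\<close> is one of a large partial sum,
  and going back through the partial sums shows that no \<open>\<psi>\<^sub>k\<close> distinguishes the two points.
\<close>

lemma generic_smooth_map:
  fixes M :: "('a, 'e::euclidean_space) manifold" and \<psi> :: "nat \<Rightarrow> 'a \<Rightarrow> real"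
  assumes "smooth_manifold M" "DIM('e) < DIM('n)"
    and "finite T" "\<And>\<tau>. \<tau> \<in> T \<Longrightarrow> smooth_map M M \<tau>"
    and \<psi>: "\<And>k. smooth_in M (points M) (\<psi> k)"
    and fin: "\<And>x. x \<in> points M \<Longrightarrow> \<exists>B k. openin (mtop M) B \<and> x \<in> B \<and> (\<forall>j\<ge>k. \<forall>y\<in>B. \<psi> j y = 0)"
  obtains F :: "'a \<Rightarrow> 'n::euclidean_space" where "smooth_in M (points M) F"
    "\<And>\<tau> p k. \<tau> \<in> T \<Longrightarrow> p \<in> points M \<Longrightarrow> F p = F (\<tau> p) \<Longrightarrow> \<psi> k p = \<psi> k (\<tau> p)"
proof -
  note cM = smooth_manifold_charted[OF assms(1)]
  have "\<exists>f. \<forall>n. smooth_in M (points M) (f n :: 'a \<Rightarrow> 'n) \<and>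
      ((\<exists>v. \<forall>x. f (Suc n) x = f n x + \<psi> n x *\<^sub>R v) \<and>
       (\<forall>\<tau>\<in>T. \<forall>p\<in>points M. f (Suc n) p = f (Suc n) (\<tau> p) \<longrightarrow> f n p = f n (\<tau> p) \<and> \<psi> n p = \<psi> n (\<tau> p)))"
  proof (rule dependent_nat_choice)
    show "\<exists>F :: 'a \<Rightarrow> 'n. smooth_in M (points M) F"
      using smooth_in_const by blast
    fix F :: "'a \<Rightarrow> 'n" and n assume F: "smooth_in M (points M) F"
    obtain v where v: "\<And>\<tau> p. \<tau> \<in> T \<Longrightarrow> p \<in> points M \<Longrightarrow>
      F p + \<psi> n p *\<^sub>R v = F (\<tau> p) + \<psi> n (\<tau> p) *\<^sub>R v \<Longrightarrow> F p = F (\<tau> p) \<and> \<psi> n p = \<psi> n (\<tau> p)"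
      using generic_step[OF assms(1-4) F \<psi>[of n]] by blast
    show "\<exists>F'. smooth_in M (points M) F' \<and> ((\<exists>v. \<forall>x. F' x = F x + \<psi> n x *\<^sub>R v) \<and>
       (\<forall>\<tau>\<in>T. \<forall>p\<in>points M. F' p = F' (\<tau> p) \<longrightarrow> F p = F (\<tau> p) \<and> \<psi> n p = \<psi> n (\<tau> p)))"
      using v by (intro exI[of _ "\<lambda>x. F x + \<psi> n x *\<^sub>R v"] conjI
          smooth_in_add[OF F smooth_in_scaleR[OF \<psi> smooth_in_const]]) auto
  qed
  then obtain f :: "nat \<Rightarrow> 'a \<Rightarrow> 'n" where f: "\<And>n. smooth_in M (points M) (f n)"
    "\<And>n. \<exists>v. \<forall>x. f (Suc n) x = f n x + \<psi> n x *\<^sub>R v"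
    "\<And>n \<tau> p. \<tau> \<in> T \<Longrightarrow> p \<in> points M \<Longrightarrow> f (Suc n) p = f (Suc n) (\<tau> p) \<Longrightarrow>
        f n p = f n (\<tau> p) \<and> \<psi> n p = \<psi> n (\<tau> p)"
    by blast
  have stable: "f j x = f k x" if "\<forall>j\<ge>k. \<psi> j x = 0" "k \<le> j" for j k x
    using that(2)
  proof (induction j rule: dec_induct)
    case (step j)
    obtain v where "\<forall>x. f (Suc j) x = f j x + \<psi> j x *\<^sub>R v" using f(2) by blast
    with step that(1) show ?case by simp
  qed simp
  \<comment> \<open>From the index \<open>K x\<close> on, the partial sums at \<open>x\<close> are constant; their value is the limit.\<close>
  define K where "K = (\<lambda>x. LEAST k. \<forall>j\<ge>k. \<psi> j x = 0)"
  have K: "\<forall>j\<ge>K x. \<psi> j x = 0" if "x \<in> points M" for x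
  proof -
    obtain k where "\<forall>j\<ge>k. \<psi> j x = 0" using fin[OF \<open>x \<in> points M\<close>] by blast
    then show ?thesis unfolding K_def by (rule LeastI)
  qed
  have K_le: "K x \<le> k" if "\<forall>j\<ge>k. \<psi> j x = 0" for k x
    unfolding K_def using that by (rule Least_le)
  define F where "F = (\<lambda>x. f (K x) x)"
  show ?thesis
  proof (rule that[of F])
    show "smooth_in M (points M) F"
    proof (rule smooth_in_local[OF cM])
      fix x assume "x \<in> points M"
      then obtain B k where B: "openin (mtop M) B" "x \<in> B" "\<forall>j\<ge>k. \<forall>y\<in>B. \<psi> j y = 0"
        using fin[OF \<open>x \<in> points M\<close>] by blast
      have "F y = f k y" if "y \<in> points M \<inter> B" for y
      proof -
        have y: "y \<in> points M" "\<forall>j\<ge>k. \<psi> j y = 0" using that B(3) by auto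
        show ?thesis using stable[OF K[OF y(1)] K_le[OF y(2)]] by (simp add: F_def)
      qed
      then have "smooth_in M (points M \<inter> B) F \<longleftrightarrow> smooth_in M (points M \<inter> B) (f k)"
        by (rule smooth_in_cong[OF cM])
      then show "\<exists>B. openin (mtop M) B \<and> x \<in> B \<and> smooth_in M (points M \<inter> B) F"
        using B(1,2) smooth_in_subset[OF f(1), of "points M \<inter> B" k] by auto
    qed
    fix \<tau> p k assume \<tau>: "\<tau> \<in> T" and p: "p \<in> points M" and eq: "F p = F (\<tau> p)"
    have "\<tau> p \<in> points M"
      using smooth_map_points[OF assms(4)[OF \<tau>] p] .
    define n where "n = Suc (max k (max (K p) (K (\<tau> p))))"
    have "f n p = f n (\<tau> p)"
      using stable[OF K[OF p], of n] stable[OF K[OF \<open>\<tau> p \<in> points M\<close>], of n] eq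
      by (simp add: F_def n_def)
    moreover have "f n p = f n (\<tau> p) \<Longrightarrow> k < n \<Longrightarrow> \<psi> k p = \<psi> k (\<tau> p)" for n
    proof (induction n)
      case (Suc n)
      then show ?case using f(3)[OF \<tau> p, of n] by (auto simp: less_Suc_eq)
    qed simp
    ultimately show "\<psi> k p = \<psi> k (\<tau> p)" by (simp add: n_def)
  qed
qed

section \<open>Finite dual bases\<close>

lemma module_hom_finsum:
  assumes "Module.module R X" "Module.module R Y" "g \<in> module_homs R X Y"
    and "finite S" "f \<in> S \<rightarrow> carrier X"
  shows "g (\<Oplus>\<^bsub>X\<^esub>s\<in>S. f s) = (\<Oplus>\<^bsub>Y\<^esub>s\<in>S. g (f s))"
proof -
  interpret X: Module.module R X by fact
  interpret Y: Module.module R Y by fact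
  have g: "g x \<in> carrier Y" "g (x \<oplus>\<^bsub>X\<^esub> y) = g x \<oplus>\<^bsub>Y\<^esub> g y"
    if "x \<in> carrier X" "y \<in> carrier X" for x y
    using assms(3) that by (auto simp: module_homs_def)
  have zero: "g \<zero>\<^bsub>X\<^esub> = \<zero>\<^bsub>Y\<^esub>"
  proof -
    have "g \<zero>\<^bsub>X\<^esub> \<oplus>\<^bsub>Y\<^esub> g \<zero>\<^bsub>X\<^esub> = g \<zero>\<^bsub>X\<^esub>"
      using g(2)[of "\<zero>\<^bsub>X\<^esub>" "\<zero>\<^bsub>X\<^esub>"] by simp
    then show ?thesis
      using g(1)[of "\<zero>\<^bsub>X\<^esub>" "\<zero>\<^bsub>X\<^esub>"] by (simp add: Y.add.r_cancel_one')
  qed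
  show ?thesis
    using assms(4,5)
  proof (induction S rule: finite_induct)
    case (insert s S)
    then have "f s \<in> carrier X" "f \<in> S \<rightarrow> carrier X" by auto
    moreover from this have "g (f s) \<in> carrier Y" "(\<lambda>s. g (f s)) \<in> S \<rightarrow> carrier Y"
      using g(1) by auto
    ultimately show ?case
      using insert g(2) by (simp add: X.finsum_insert Y.finsum_insert X.finsum_closed)
  qed (simp add: zero)
qed

text \<open>
  A map \<open>f\<close> on \<open>X\<close> is lifted through a surjection by choosing preimages \<open>y s\<close> of the values \<open>f s\<close> on the
  generators and setting \<open>h x = \<Sum> \<phi> s x \<odot> y s\<close>; linearity of the functionals makes \<open>h\<close> a
  homomorphism even if the generators satisfy relations.
\<close>

lemma dual_basis_imp_projective:
  fixes R :: "'r ring" and X :: "('r, 'a) module"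
  assumes X: "Module.module R X" and S: "finite S" "S \<subseteq> carrier X"
    and \<phi>: "\<And>s x. s \<in> S \<Longrightarrow> x \<in> carrier X \<Longrightarrow> \<phi> s x \<in> carrier R"
      "\<And>s x y. s \<in> S \<Longrightarrow> x \<in> carrier X \<Longrightarrow> y \<in> carrier X \<Longrightarrow> \<phi> s (x \<oplus>\<^bsub>X\<^esub> y) = \<phi> s x \<oplus>\<^bsub>R\<^esub> \<phi> s y"
      "\<And>s r x. s \<in> S \<Longrightarrow> r \<in> carrier R \<Longrightarrow> x \<in> carrier X \<Longrightarrow> \<phi> s (r \<odot>\<^bsub>X\<^esub> x) = r \<otimes>\<^bsub>R\<^esub> \<phi> s x"
    and expand: "\<And>x. x \<in> carrier X \<Longrightarrow> x = (\<Oplus>\<^bsub>X\<^esub>s\<in>S. \<phi> s x \<odot>\<^bsub>X\<^esub> s)"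
  shows "finitely_generated_module R X \<and> projective_module TYPE('b) TYPE('c) R X"
proof
  have "\<exists>c\<in>S \<rightarrow> carrier R. x = (\<Oplus>\<^bsub>X\<^esub>s\<in>S. c s \<odot>\<^bsub>X\<^esub> s)" if "x \<in> carrier X" for x
    using expand[OF that] \<phi>(1) that by (intro bexI[of _ "\<lambda>s. \<phi> s x"]) auto
  with X S show "finitely_generated_module R X"
    unfolding finitely_generated_module_def by blast
  interpret X: Module.module R X by fact
  show "projective_module TYPE('b) TYPE('c) R X"
    unfolding projective_module_def
  proof (intro conjI X allI impI; elim conjE)
    fix Y :: "('r, 'b) module" and Z :: "('r, 'c) module" and f g
    assume Y: "Module.module R Y" and Z: "Module.module R Z" and g: "g \<in> module_homs R Y Z"
      and onto: "g ` carrier Y = carrier Z" and f: "f \<in> module_homs R X Z"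
    interpret Y: Module.module R Y by fact
    have "\<exists>y\<in>carrier Y. g y = f s" if "s \<in> S" for s
    proof -
      have "f s \<in> g ` carrier Y"
        using f that S(2) onto by (auto simp: module_homs_def)
      then show ?thesis by auto
    qed
    then obtain y where y: "\<And>s. s \<in> S \<Longrightarrow> y s \<in> carrier Y" "\<And>s. s \<in> S \<Longrightarrow> g (y s) = f s"
      by metis
    define h where "h = (\<lambda>x. \<Oplus>\<^bsub>Y\<^esub>s\<in>S. \<phi> s x \<odot>\<^bsub>Y\<^esub> y s)"
    have Yin: "(\<lambda>s. \<phi> s x \<odot>\<^bsub>Y\<^esub> y s) \<in> S \<rightarrow> carrier Y" if "x \<in> carrier X" for x
      using \<phi>(1) y(1) that by auto
    have "h \<in> module_homs R X Y"
      unfolding module_homs_def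
    proof (intro CollectI conjI ballI funcsetI)
      fix x assume x: "x \<in> carrier X"
      show "h x \<in> carrier Y"
        unfolding h_def by (rule Y.finsum_closed[OF Yin[OF x]])
      fix x' assume x': "x' \<in> carrier X"
      have "h (x \<oplus>\<^bsub>X\<^esub> x') = (\<Oplus>\<^bsub>Y\<^esub>s\<in>S. \<phi> s x \<odot>\<^bsub>Y\<^esub> y s \<oplus>\<^bsub>Y\<^esub> \<phi> s x' \<odot>\<^bsub>Y\<^esub> y s)"
        unfolding h_def
        by (rule Y.finsum_cong') (use x x' \<phi>(1,2) y(1) in \<open>auto simp: Y.smult_l_distr\<close>)
      also have "\<dots> = h x \<oplus>\<^bsub>Y\<^esub> h x'"
        unfolding h_def by (rule Y.finsum_addf[OF Yin[OF x] Yin[OF x']])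
      finally show "h (x \<oplus>\<^bsub>X\<^esub> x') = h x \<oplus>\<^bsub>Y\<^esub> h x'" .
    next
      fix r x assume r: "r \<in> carrier R" and x: "x \<in> carrier X"
      have "h (r \<odot>\<^bsub>X\<^esub> x) = (\<Oplus>\<^bsub>Y\<^esub>s\<in>S. r \<odot>\<^bsub>Y\<^esub> (\<phi> s x \<odot>\<^bsub>Y\<^esub> y s))"
        unfolding h_def
        by (rule Y.finsum_cong') (use r x \<phi>(1,3) y(1) in \<open>auto simp: Y.smult_assoc1\<close>)
      also have "\<dots> = r \<odot>\<^bsub>Y\<^esub> h x"
        unfolding h_def by (rule Y.finsum_smult_ldistr[OF S(1) r Yin[OF x], symmetric])
      finally show "h (r \<odot>\<^bsub>X\<^esub> x) = r \<odot>\<^bsub>Y\<^esub> h x" .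
    qed
    moreover have "g (h x) = f x" if x: "x \<in> carrier X" for x
    proof -
      interpret Z: Module.module R Z by fact
      have Xin: "(\<lambda>s. \<phi> s x \<odot>\<^bsub>X\<^esub> s) \<in> S \<rightarrow> carrier X"
        using \<phi>(1) S(2) x by auto
      have "g (h x) = (\<Oplus>\<^bsub>Z\<^esub>s\<in>S. g (\<phi> s x \<odot>\<^bsub>Y\<^esub> y s))"
        unfolding h_def by (rule module_hom_finsum[OF Y Z g S(1) Yin[OF x]])
      also have "\<dots> = (\<Oplus>\<^bsub>Z\<^esub>s\<in>S. f (\<phi> s x \<odot>\<^bsub>X\<^esub> s))"
      proof (rule Z.finsum_cong')
        show "(\<lambda>s. f (\<phi> s x \<odot>\<^bsub>X\<^esub> s)) \<in> S \<rightarrow> carrier Z"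
          using f Xin by (auto simp: module_homs_def)
        show "g (\<phi> s x \<odot>\<^bsub>Y\<^esub> y s) = f (\<phi> s x \<odot>\<^bsub>X\<^esub> s)" if "s \<in> S" for s
          using f g y[OF that] \<phi>(1)[OF that x] S(2) that by (auto simp: module_homs_def)
      qed simp
      also have "\<dots> = f (\<Oplus>\<^bsub>X\<^esub>s\<in>S. \<phi> s x \<odot>\<^bsub>X\<^esub> s)"
        by (rule module_hom_finsum[OF X Z f S(1) Xin, symmetric])
      finally show ?thesis
        using expand[OF x] by simp
    qed
    ultimately show "\<exists>h\<in>module_homs R X Y. \<forall>x\<in>carrier X. g (h x) = f x" by blast
  qed
qed

section \<open>Smooth functions as a ring and as a module\<close>

lemma smooth_functions_iff:
  assumes "charted M"
  shows "f \<in> smooth_functions M \<longleftrightarrow> f \<in> extensional (points M) \<and> smooth_in M (points M) f"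
proof -
  have "U \<inter> points M = U" if "(U, \<phi>) \<in> atlas M" for U \<phi>
    using chart_subset[OF charted_chart[OF assms that]] by auto
  then show ?thesis
    by (fastforce simp: smooth_functions_def smooth_in_def)
qed

lemma restrict_smooth_functions:
  assumes "charted M" "smooth_in M (points M) f"
  shows "restrict f (points M) \<in> smooth_functions M"
  using assms smooth_in_cong[OF assms(1), of "points M" "restrict f (points M)" f]
  by (simp add: smooth_functions_iff)

text \<open>
  Stated for an arbitrary record with these additive operations, so as to apply both to the ring
  and to the module.
\<close>

lemma smooth_functions_abelian_group:
  fixes X :: "('a \<Rightarrow> complex, 'z) ring_scheme"
  assumes "charted M" "carrier X = smooth_functions M"
    and "add X = (\<lambda>f g. \<lambda>x\<in>points M. f x + g x)" "zero X = (\<lambda>x\<in>points M. 0)"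
  shows "abelian_group X"
proof (rule abelian_groupI, unfold assms(2-4))
  note sm = smooth_functions_iff[OF assms(1)] and cl = restrict_smooth_functions[OF assms(1)]
  show "(\<lambda>x\<in>points M. f x + g x) \<in> smooth_functions M"
    if "f \<in> smooth_functions M" "g \<in> smooth_functions M" for f g
    using that by (intro cl smooth_in_add) (auto simp: sm)
  show "(\<lambda>x\<in>points M. 0) \<in> smooth_functions M"
    by (intro cl smooth_in_const)
  show "(\<lambda>x\<in>points M. (\<lambda>x\<in>points M. 0) x + f x) = f" if "f \<in> smooth_functions M" for f
    using that by (auto simp: sm extensional_def fun_eq_iff)
  show "\<exists>g\<in>smooth_functions M. (\<lambda>x\<in>points M. g x + f x) = (\<lambda>x\<in>points M. 0)"
    if "f \<in> smooth_functions M" for f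
  proof
    show "(\<lambda>x\<in>points M. - f x) \<in> smooth_functions M"
      using that
      by (intro cl smooth_in_linear[OF bounded_linear_minus[OF bounded_linear_ident]]) (auto simp: sm)
    show "(\<lambda>x\<in>points M. (\<lambda>x\<in>points M. - f x) x + f x) = (\<lambda>x\<in>points M. 0)"
      by (auto simp: fun_eq_iff)
  qed
qed (auto simp: fun_eq_iff add_ac)

lemma finsum_smooth_functions:
  fixes X :: "('a \<Rightarrow> complex, 'z) ring_scheme"
  assumes "charted M" "carrier X = smooth_functions M"
    and "add X = (\<lambda>f g. \<lambda>x\<in>points M. f x + g x)" "zero X = (\<lambda>x\<in>points M. 0)"
    and "finite S" "f \<in> S \<rightarrow> smooth_functions M"
  shows "(\<Oplus>\<^bsub>X\<^esub>s\<in>S. f s) = (\<lambda>x\<in>points M. \<Sum>s\<in>S. f s x)"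
proof -
  interpret abelian_group X
    by (rule smooth_functions_abelian_group[OF assms(1-4)])
  show ?thesis
    using assms(5,6)
  proof (induction S rule: finite_induct)
    case (insert s S)
    then have "f \<in> S \<rightarrow> carrier X" "f s \<in> carrier X" by (auto simp: assms(2))
    with insert show ?case
      by (subst finsum_insert) (auto simp: assms(3) fun_eq_iff)
  qed (simp add: assms(4))
qed

lemma smooth_ring_cring:
  assumes "charted M"
  shows "cring (smooth_ring M)"
proof (rule cringI)
  note sm = smooth_functions_iff[OF assms] and cl = restrict_smooth_functions[OF assms]
  show "abelian_group (smooth_ring M)"
    by (rule smooth_functions_abelian_group[OF assms]) (simp_all add: smooth_ring_def)
  show "comm_monoid (smooth_ring M)"
  proof (rule comm_monoidI)
    show "f \<otimes>\<^bsub>smooth_ring M\<^esub> g \<in> carrier (smooth_ring M)"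
      if "f \<in> carrier (smooth_ring M)" "g \<in> carrier (smooth_ring M)" for f g
    proof -
      have "smooth_in M (points M) f" "smooth_in M (points M) g"
        using that by (simp_all add: smooth_ring_def sm)
      then show ?thesis by (simp add: smooth_ring_def cl smooth_in_mult)
    qed
    show "\<one>\<^bsub>smooth_ring M\<^esub> \<in> carrier (smooth_ring M)"
      by (simp add: smooth_ring_def cl smooth_in_const)
    show "\<one>\<^bsub>smooth_ring M\<^esub> \<otimes>\<^bsub>smooth_ring M\<^esub> f = f" if "f \<in> carrier (smooth_ring M)" for f
      using that by (auto simp: smooth_ring_def sm extensional_def fun_eq_iff)
  qed (auto simp: smooth_ring_def fun_eq_iff mult_ac)
qed (auto simp: smooth_ring_def fun_eq_iff distrib_right)

lemma smooth_module_module: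
  assumes "charted P" "charted M" "smooth_map P M q"
  shows "Module.module (smooth_ring M) (smooth_module P q)"
proof -
  note smP = smooth_functions_iff[OF assms(1)] and smM = smooth_functions_iff[OF assms(2)]
  note q = smooth_map_points[OF assms(3)]
  show ?thesis
  proof (rule moduleI)
    show "cring (smooth_ring M)"
      by (rule smooth_ring_cring[OF assms(2)])
    show "abelian_group (smooth_module P q)"
      by (rule smooth_functions_abelian_group[OF assms(1)]) (simp_all add: smooth_module_def)
    fix a x assume a: "a \<in> carrier (smooth_ring M)" and x: "x \<in> carrier (smooth_module P q)"
    have "smooth_in P (points P) (\<lambda>p. a (q p))"
      using a q by (intro smooth_in_pullback[OF assms openin_topspace]) (auto simp: smooth_ring_def smM)
    moreover have "smooth_in P (points P) x"
      using x by (simp add: smooth_module_def smP)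
    ultimately show "a \<odot>\<^bsub>smooth_module P q\<^esub> x \<in> carrier (smooth_module P q)"
      by (simp add: smooth_module_def restrict_smooth_functions[OF assms(1)] smooth_in_mult)
  next
    show "\<one>\<^bsub>smooth_ring M\<^esub> \<odot>\<^bsub>smooth_module P q\<^esub> x = x" if "x \<in> carrier (smooth_module P q)" for x
      using that q by (auto simp: smooth_module_def smooth_ring_def fun_eq_iff smP extensional_def)
  qed (use q in \<open>auto simp: smooth_module_def smooth_ring_def fun_eq_iff algebra_simps\<close>)
qed

section \<open>Separable kernels\<close>

text \<open>
  Kernels of finite rank, the algebraic tensor product of the smooth functions with themselves.
  The second factors are indexed by themselves: they will be the generators of the module.
\<close>

definition separable_kernel ::
    "('a, 'e::euclidean_space) manifold \<Rightarrow> ('a \<Rightarrow> 'a \<Rightarrow> complex) \<Rightarrow> bool" where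
  "separable_kernel M K \<longleftrightarrow>
     (\<exists>S a. finite S \<and> S \<subseteq> smooth_functions M \<and> (\<forall>b\<in>S. smooth_in M (points M) (a b)) \<and>
        (\<forall>x\<in>points M. \<forall>y\<in>points M. K x y = (\<Sum>b\<in>S. a b x * b y)))"

lemma separable_kernel_cong:
  assumes "\<And>x y. x \<in> points M \<Longrightarrow> y \<in> points M \<Longrightarrow> K x y = L x y" "separable_kernel M L"
  shows "separable_kernel M K"
  using assms(2) unfolding separable_kernel_def by (simp add: assms(1) cong: ball_cong)

lemma separable_kernel_tensor:
  assumes "charted M" "smooth_in M (points M) f" "smooth_in M (points M) g"
  shows "separable_kernel M (\<lambda>x y. f x * g y)"
  unfolding separable_kernel_def
  using assms restrict_smooth_functions[OF assms(1,3)]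
  by (intro exI[of _ "{restrict g (points M)}"] exI[of _ "\<lambda>b. f"]) auto

lemma separable_kernel_add:
  assumes "charted M" "separable_kernel M K" "separable_kernel M L"
  shows "separable_kernel M (\<lambda>x y. K x y + L x y)"
proof -
  obtain S a where K: "finite S" "S \<subseteq> smooth_functions M" "\<forall>b\<in>S. smooth_in M (points M) (a b)"
    "\<forall>x\<in>points M. \<forall>y\<in>points M. K x y = (\<Sum>b\<in>S. a b x * b y)"
    using assms(2) unfolding separable_kernel_def by auto
  obtain S' a' where L: "finite S'" "S' \<subseteq> smooth_functions M" "\<forall>b\<in>S'. smooth_in M (points M) (a' b)"
    "\<forall>x\<in>points M. \<forall>y\<in>points M. L x y = (\<Sum>b\<in>S'. a' b x * b y)"
    using assms(3) unfolding separable_kernel_def by auto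
  define c where "c = (\<lambda>b x. (if b \<in> S then a b x else 0) + (if b \<in> S' then a' b x else 0))"
  have "smooth_in M (points M) (\<lambda>x. if b \<in> S then a b x else 0)"
    "smooth_in M (points M) (\<lambda>x. if b \<in> S' then a' b x else 0)" for b
    using K(3) L(3) by (cases "b \<in> S"; cases "b \<in> S'"; simp add: smooth_in_const)+
  then have "smooth_in M (points M) (c b)" for b
    unfolding c_def by (intro smooth_in_add)
  moreover have "K x y + L x y = (\<Sum>b\<in>S \<union> S'. c b x * b y)" if "x \<in> points M" "y \<in> points M" for x y
  proof -
    have "(\<Sum>b\<in>S. a b x * b y) = (\<Sum>b\<in>S \<union> S'. (if b \<in> S then a b x else 0) * b y)"
      using K(1) L(1) by (intro sum.mono_neutral_cong_left) auto
    moreover have "(\<Sum>b\<in>S'. a' b x * b y) = (\<Sum>b\<in>S \<union> S'. (if b \<in> S' then a' b x else 0) * b y)"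
      using K(1) L(1) by (intro sum.mono_neutral_cong_left) auto
    ultimately show ?thesis
      using K(4) L(4) that by (simp add: c_def distrib_right sum.distrib)
  qed
  ultimately show ?thesis
    unfolding separable_kernel_def using K(1,2) L(1,2)
    by (intro exI[of _ "S \<union> S'"] exI[of _ c]) auto
qed

lemma separable_kernel_sum:
  assumes "charted M" "\<And>i. i \<in> I \<Longrightarrow> separable_kernel M (K i)"
  shows "separable_kernel M (\<lambda>x y. \<Sum>i\<in>I. K i x y)"
proof -
  have "separable_kernel M (\<lambda>x y. 0)"
    using separable_kernel_tensor[OF assms(1) smooth_in_const smooth_in_const, of 0 0] by simp
  then show ?thesis
    using assms(2)
    by (induction I rule: infinite_finite_induct) (auto intro: separable_kernel_add[OF assms(1)])
qed

lemma separable_kernel_mult: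
  assumes "charted M" "separable_kernel M K" "separable_kernel M L"
  shows "separable_kernel M (\<lambda>x y. K x y * L x y)"
proof -
  obtain S a where K: "S \<subseteq> smooth_functions M" "\<forall>b\<in>S. smooth_in M (points M) (a b)"
    "\<forall>x\<in>points M. \<forall>y\<in>points M. K x y = (\<Sum>b\<in>S. a b x * b y)"
    using assms(2) unfolding separable_kernel_def by auto
  obtain S' a' where L: "S' \<subseteq> smooth_functions M" "\<forall>b\<in>S'. smooth_in M (points M) (a' b)"
    "\<forall>x\<in>points M. \<forall>y\<in>points M. L x y = (\<Sum>b\<in>S'. a' b x * b y)"
    using assms(3) unfolding separable_kernel_def by auto
  have "separable_kernel M (\<lambda>x y. \<Sum>b\<in>S. \<Sum>b'\<in>S'. (a b x * a' b' x) * (b y * b' y))"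
    using K(1,2) L(1,2)
    by (intro separable_kernel_sum separable_kernel_tensor smooth_in_mult assms(1))
      (auto simp: smooth_functions_iff[OF assms(1)])
  then show ?thesis
  proof (rule separable_kernel_cong[rotated])
    fix x y assume "x \<in> points M" "y \<in> points M"
    then have "K x y * L x y = (\<Sum>b\<in>S. a b x * b y) * (\<Sum>b\<in>S'. a' b x * b y)"
      using K(3) L(3) by simp
    then show "K x y * L x y = (\<Sum>b\<in>S. \<Sum>b'\<in>S'. (a b x * a' b' x) * (b y * b' y))"
      by (simp add: sum_product mult.assoc mult.left_commute)
  qed
qed

lemma separable_kernel_prod:
  assumes "charted M" "\<And>i. i \<in> I \<Longrightarrow> separable_kernel M (K i)"
  shows "separable_kernel M (\<lambda>x y. \<Prod>i\<in>I. K i x y)"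
proof -
  have "separable_kernel M (\<lambda>x y. 1)"
    using separable_kernel_tensor[OF assms(1) smooth_in_const smooth_in_const, of 1 1] by simp
  then show ?thesis
    using assms(2)
    by (induction I rule: infinite_finite_induct) (auto intro: separable_kernel_mult[OF assms(1)])
qed

text \<open>
  Expanding the inner product in the standard basis, each coordinate contributes one tensor.
\<close>

lemma separable_kernel_inner:
  fixes F u :: "'a \<Rightarrow> 'n::euclidean_space" and c :: "'a \<Rightarrow> real"
  assumes "charted M" "smooth_in M (points M) u" "smooth_in M (points M) F" "smooth_in M (points M) c"
  shows "separable_kernel M (\<lambda>x y. complex_of_real (u x \<bullet> F y + c x))"
proof -
  have "separable_kernel M (\<lambda>x y. (\<Sum>b\<in>Basis. complex_of_real (u x \<bullet> b) * complex_of_real (F y \<bullet> b)) +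
      complex_of_real (c x) * 1)"
    using assms
    by (intro separable_kernel_add separable_kernel_sum separable_kernel_tensor smooth_in_const
        smooth_in_linear[OF bounded_linear_of_real] smooth_in_linear[OF bounded_linear_inner_left])
  moreover have "complex_of_real (u x \<bullet> F y) = (\<Sum>b\<in>Basis. complex_of_real (u x \<bullet> b) * complex_of_real (F y \<bullet> b))"
    for x y
    by (subst euclidean_inner) simp
  ultimately show ?thesis by simp
qed

section \<open>Finite coverings\<close>

locale finite_covering =
  fixes P :: "('p, 'e::euclidean_space) manifold" and M :: "('m, 'f::euclidean_space) manifold"
    and G :: "('g, 'h::euclidean_space) lie_group"
    and q :: "'p \<Rightarrow> 'm" and \<sigma> :: "'p \<Rightarrow> 'g \<Rightarrow> 'p"
  assumes principal: "principal_bundle P M G q \<sigma>"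
    and finite_G: "finite (carrier G)"
begin

lemma smooth_P: "smooth_manifold P" and smooth_M: "smooth_manifold M"
  and group_G: "group G" and smooth_G: "smooth_manifold (lie_manifold G)"
  and points_G: "points (lie_manifold G) = carrier G" and smooth_q: "smooth_map P M q"
  using principal by (auto simp: principal_bundle_def is_lie_group_def)

lemmas charted_P = smooth_manifold_charted[OF smooth_P]
  and charted_M = smooth_manifold_charted[OF smooth_M]
  and charted_G = smooth_manifold_charted[OF smooth_G]

lemma q_points: "p \<in> points P \<Longrightarrow> q p \<in> points M"
  by (rule smooth_map_points[OF smooth_q])

lemma smooth_act:
  assumes "g \<in> carrier G"
  shows "smooth_map P P (\<lambda>p. \<sigma> p g)"
proof -
  have "smooth_map (prod_manifold P (lie_manifold G)) P (\<lambda>(p, g). \<sigma> p g)"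
    using principal by (simp add: principal_bundle_def smooth_right_action_def)
  from smooth_map_slice[OF charted_P charted_G this, of g] assms show ?thesis
    by (simp add: points_G)
qed

lemma act_points: "g \<in> carrier G \<Longrightarrow> p \<in> points P \<Longrightarrow> \<sigma> p g \<in> points P"
  using smooth_map_points[OF smooth_act] .

text \<open>
  The properties of a local trivialization \<open>s\<close> that are used below. Currying it exposes the sheets
  \<open>\<lambda>x. s x g\<close>, local sections of \<open>q\<close> with open images.
\<close>

definition trivial_over :: "'m set \<Rightarrow> ('m \<Rightarrow> 'g \<Rightarrow> 'p) \<Rightarrow> bool" where
  "trivial_over U s \<longleftrightarrow> openin (mtop M) U \<and>
     (\<forall>x\<in>U. bij_betw (s x) (carrier G) {p \<in> points P. q p = x}) \<and>
     (\<forall>x\<in>U. \<forall>g\<in>carrier G. \<forall>h\<in>carrier G. s x (g \<otimes>\<^bsub>G\<^esub> h) = \<sigma> (s x g) h) \<and>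
     (\<forall>g\<in>carrier G. openin (mtop P) ((\<lambda>x. s x g) ` U)) \<and>
     (\<forall>g\<in>carrier G. \<forall>h :: 'p \<Rightarrow> complex. smooth_in P (points P) h \<longrightarrow> smooth_in M U (\<lambda>x. h (s x g)))"

lemma trivial_overD:
  assumes "trivial_over U s"
  shows "openin (mtop M) U"
    and "x \<in> U \<Longrightarrow> bij_betw (s x) (carrier G) {p \<in> points P. q p = x}"
    and "x \<in> U \<Longrightarrow> g \<in> carrier G \<Longrightarrow> h \<in> carrier G \<Longrightarrow> s x (g \<otimes>\<^bsub>G\<^esub> h) = \<sigma> (s x g) h"
    and "g \<in> carrier G \<Longrightarrow> openin (mtop P) ((\<lambda>x. s x g) ` U)"
    and "g \<in> carrier G \<Longrightarrow> smooth_in P (points P) (k :: 'p \<Rightarrow> complex) \<Longrightarrow>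
      smooth_in M U (\<lambda>x. k (s x g))"
  using assms by (simp_all add: trivial_over_def)

text \<open>
  The sheets are open because a finite Hausdorff space is discrete.
\<close>

lemma trivialization:
  assumes "m \<in> points M"
  obtains U s where "m \<in> U" "trivial_over U s"
proof -
  have "\<exists>U D. openin (mtop M) U \<and> m \<in> U \<and>
        diffeomorphism (prod_manifold (open_submanifold M U) (lie_manifold G))
          (open_submanifold P {p \<in> points P. q p \<in> U}) D \<and>
        (\<forall>x\<in>U. \<forall>g\<in>carrier G. q (D (x, g)) = x) \<and>
        (\<forall>x\<in>U. \<forall>g\<in>carrier G. \<forall>h\<in>carrier G. D (x, g \<otimes>\<^bsub>G\<^esub> h) = \<sigma> (D (x, g)) h)"
    using principal assms by (simp add: principal_bundle_def)
  then obtain U D where U: "openin (mtop M) U" "m \<in> U"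
    and D: "diffeomorphism (prod_manifold (open_submanifold M U) (lie_manifold G))
          (open_submanifold P {p \<in> points P. q p \<in> U}) D"
    and qD: "\<And>x g. x \<in> U \<Longrightarrow> g \<in> carrier G \<Longrightarrow> q (D (x, g)) = x"
    and equi: "\<And>x g h. x \<in> U \<Longrightarrow> g \<in> carrier G \<Longrightarrow> h \<in> carrier G \<Longrightarrow> D (x, g \<otimes>\<^bsub>G\<^esub> h) = \<sigma> (D (x, g)) h"
    by (elim exE conjE) simp
  define V where "V = {p \<in> points P. q p \<in> U}"
  let ?N = "prod_manifold (open_submanifold M U) (lie_manifold G)" and ?Q = "open_submanifold P V"
  have UM: "U \<subseteq> points M" using U(1) by (rule openin_subset)
  have openV: "openin (mtop P) V"
    unfolding V_def using smooth_q U(1) by (auto simp: smooth_map_def intro: openin_continuous_map_preimage)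
  have points: "points (open_submanifold M U) = U" "points ?Q = V"
    using UM by (auto simp: open_submanifold_def V_def)
  have pointsN: "points ?N = U \<times> carrier G"
    using points(1) points_G by (simp add: prod_manifold_def)
  obtain E where smD: "smooth_map ?N ?Q D" and smE: "smooth_map ?Q ?N E"
    and ED: "\<And>z. z \<in> U \<times> carrier G \<Longrightarrow> E (D z) = z" and DE: "\<And>p. p \<in> V \<Longrightarrow> D (E p) = p"
    using D unfolding diffeomorphism_def V_def[symmetric] pointsN points by blast
  have D_in: "D z \<in> V" if "z \<in> U \<times> carrier G" for z
    using smooth_map_points[OF smD, of z] that by (simp add: pointsN points)
  have E_in: "E p \<in> U \<times> carrier G" if "p \<in> V" for p
    using smooth_map_points[OF smE, of p] that by (simp add: pointsN points)
  have qE: "fst (E p) = q p" if "p \<in> V" for p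
    using qD[of "fst (E p)" "snd (E p)"] E_in[OF that] DE[OF that] by auto
  have chM: "charted (open_submanifold M U)" and chQ: "charted ?Q"
    by (rule charted_open_submanifold charted_M charted_P U(1) openV)+
  show ?thesis
  proof (rule that[of U "\<lambda>x g. D (x, g)", OF U(2)], unfold trivial_over_def, intro conjI ballI allI impI U(1))
    show "bij_betw (\<lambda>g. D (x, g)) (carrier G) {p \<in> points P. q p = x}" if x: "x \<in> U" for x
    proof (rule bij_betw_byWitness[where f' = "\<lambda>p. snd (E p)"])
      show "\<forall>g\<in>carrier G. snd (E (D (x, g))) = g"
        using ED x by simp
      show "\<forall>p\<in>{p \<in> points P. q p = x}. D (x, snd (E p)) = p"
      proof
        fix p assume "p \<in> {p \<in> points P. q p = x}"
        then have "p \<in> V" "q p = x" using x by (auto simp: V_def)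
        then show "D (x, snd (E p)) = p"
          using qE[of p] DE[of p] by (metis prod.collapse)
      qed
      show "(\<lambda>g. D (x, g)) ` carrier G \<subseteq> {p \<in> points P. q p = x}"
        using D_in qD x by (auto simp: V_def)
      show "(\<lambda>p. snd (E p)) ` {p \<in> points P. q p = x} \<subseteq> carrier G"
        using E_in x by (fastforce simp: V_def mem_Times_iff)
    qed
    show "D (x, g \<otimes>\<^bsub>G\<^esub> h) = \<sigma> (D (x, g)) h"
      if "x \<in> U" "g \<in> carrier G" "h \<in> carrier G" for x g h
      using equi[OF that] .
    show "openin (mtop P) ((\<lambda>x. D (x, g)) ` U)" if g: "g \<in> carrier G" for g
    proof -
      have "t1_space (mtop (lie_manifold G))"
        using smooth_G by (auto simp: smooth_manifold_def intro: Hausdorff_imp_t1_space)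
      then have "closedin (mtop (lie_manifold G)) (carrier G - {g})"
        using finite_G points_G by (auto simp: t1_space_closedin_finite)
      then have "openin (mtop (lie_manifold G)) (carrier G - (carrier G - {g}))"
        using points_G by (metis openin_diff openin_topspace)
      then have "openin (mtop (lie_manifold G)) {g}"
        using g by (simp add: double_diff)
      moreover have "continuous_map (mtop ?Q) (prod_topology (mtop (open_submanifold M U)) (mtop (lie_manifold G))) E"
        using smE by (simp add: smooth_map_def prod_manifold_def)
      then have "continuous_map (mtop ?Q) (mtop (lie_manifold G)) (snd \<circ> E)"
        by (rule continuous_map_compose[OF _ continuous_map_snd])
      ultimately have "openin (mtop ?Q) {p \<in> points ?Q. (snd \<circ> E) p \<in> {g}}"
        by (intro openin_continuous_map_preimage)
      then have "openin (subtopology (mtop P) V) {p \<in> V. snd (E p) = g}"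
        by (simp add: points(2)) (simp add: open_submanifold_def)
      then have "openin (mtop P) {p \<in> V. snd (E p) = g}"
        using openV by (simp add: openin_open_subtopology)
      moreover have "{p \<in> V. snd (E p) = g} = (\<lambda>x. D (x, g)) ` U"
      proof (intro equalityI subsetI)
        fix p assume p: "p \<in> {p \<in> V. snd (E p) = g}"
        then have "E p = (fst (E p), g)" "fst (E p) \<in> U"
          using E_in[of p] by (auto simp: prod_eq_iff mem_Times_iff)
        then show "p \<in> (\<lambda>x. D (x, g)) ` U"
          using DE[of p] p by (metis (mono_tags, lifting) imageI mem_Collect_eq)
      next
        fix p assume "p \<in> (\<lambda>x. D (x, g)) ` U"
        then show "p \<in> {p \<in> V. snd (E p) = g}"
          using D_in ED g by auto
      qed
      ultimately show ?thesis by simp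
    qed
    show "smooth_in M U (\<lambda>x. h (D (x, g)))"
      if g: "g \<in> carrier G" and h: "smooth_in P (points P) h" for g and h :: "'p \<Rightarrow> complex"
    proof -
      have "smooth_map (open_submanifold M U) ?Q (\<lambda>x. D (x, g))"
        using smooth_map_slice[OF chM charted_G smD, of g] g points_G by simp
      moreover have "smooth_in ?Q V h"
        using smooth_in_subset[OF h, of V] by (simp add: smooth_in_open_submanifold[OF charted_P] V_def)
      moreover have "openin (mtop ?Q) V"
        using openin_topspace[of "mtop ?Q"] points(2) by simp
      ultimately have "smooth_in (open_submanifold M U) U (\<lambda>x. h (D (x, g)))"
        using D_in g points(1) by (intro smooth_in_pullback[OF chM chQ, where A = V]) auto
      then show ?thesis by (simp add: smooth_in_open_submanifold[OF charted_M])
    qed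
  qed
qed

text \<open>
  Everything is read off in a trivialization around \<open>q p\<close>, where the group acts on the fibre by
  right multiplication. The neighbourhood in the last claim is the sheet through \<open>p\<close>: a nontrivial
  group element moves it to a different sheet.
\<close>

lemma
  assumes p: "p \<in> points P"
  shows act_transitive: "p' \<in> points P \<Longrightarrow> q p' = q p \<Longrightarrow> \<exists>g\<in>carrier G. p' = \<sigma> p g"
    and finite_fibre: "finite {p' \<in> points P. q p' = q p}"
    and small_neighbourhood: "\<exists>W. openin (mtop P) W \<and> p \<in> W \<and> (\<forall>x\<in>W. \<forall>g\<in>carrier G - {\<one>\<^bsub>G\<^esub>}. \<sigma> x g \<notin> W)"
proof -
  interpret group G by (rule group_G)
  obtain U s where p_in: "q p \<in> U" and U: "trivial_over U s"
    using trivialization[OF q_points[OF p]] .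
  note bij = trivial_overD(2)[OF U] and equi = trivial_overD(3)[OF U] and opn = trivial_overD(4)[OF U]
  have D: "s x g \<in> points P" "q (s x g) = x" if "x \<in> U" "g \<in> carrier G" for x g
    using bij_betwE[OF bij[OF that(1)]] that(2) by auto
  have surj: "\<exists>g\<in>carrier G. p' = s (q p) g" if "p' \<in> points P" "q p' = q p" for p'
    using bij[OF p_in] that unfolding bij_betw_def by (auto simp: set_eq_iff image_iff)
  obtain k where k: "k \<in> carrier G" "p = s (q p) k"
    using surj[OF p] by blast
  show "\<exists>g\<in>carrier G. p' = \<sigma> p g" if p': "p' \<in> points P" "q p' = q p"
  proof -
    obtain l where l: "l \<in> carrier G" "p' = s (q p) l"
      using surj[OF p'] by blast
    have "k \<otimes>\<^bsub>G\<^esub> (inv\<^bsub>G\<^esub> k \<otimes>\<^bsub>G\<^esub> l) = l"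
      using k(1) l(1) by (simp flip: m_assoc)
    then have "p' = \<sigma> p (inv\<^bsub>G\<^esub> k \<otimes>\<^bsub>G\<^esub> l)"
      using equi[OF p_in k(1), of "inv\<^bsub>G\<^esub> k \<otimes>\<^bsub>G\<^esub> l"] k l by simp
    then show ?thesis using k(1) l(1) by blast
  qed
  show "finite {p' \<in> points P. q p' = q p}"
    using bij_betw_finite[OF bij[OF p_in]] finite_G by simp
  show "\<exists>W. openin (mtop P) W \<and> p \<in> W \<and> (\<forall>x\<in>W. \<forall>g\<in>carrier G - {\<one>\<^bsub>G\<^esub>}. \<sigma> x g \<notin> W)"
  proof (intro exI conjI ballI)
    let ?W = "(\<lambda>x. s x k) ` U"
    show "openin (mtop P) ?W" by (rule opn[OF k(1)])
    show "p \<in> ?W" using k(2) p_in by blast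
    fix y g assume "y \<in> ?W" and g: "g \<in> carrier G - {\<one>\<^bsub>G\<^esub>}"
    then obtain x where x: "x \<in> U" "y = s x k" by blast
    have eq: "\<sigma> y g = s x (k \<otimes>\<^bsub>G\<^esub> g)"
      using equi[OF x(1) k(1)] g x(2) by simp
    have kg: "k \<otimes>\<^bsub>G\<^esub> g \<in> carrier G" "k \<otimes>\<^bsub>G\<^esub> g \<noteq> k"
      using k(1) g by (auto simp: r_cancel_one)
    show "\<sigma> y g \<notin> ?W"
    proof
      assume "\<sigma> y g \<in> ?W"
      then obtain x' where x': "x' \<in> U" "\<sigma> y g = s x' k" by blast
      have "x' = x"
        using D(2)[OF x(1) kg(1)] D(2)[OF x'(1) k(1)] eq x'(2) by simp
      then have "s x (k \<otimes>\<^bsub>G\<^esub> g) = s x k" using eq x'(2) by simp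
      then show False
        using inj_onD[OF bij_betw_imp_inj_on[OF bij[OF x(1)]], of "k \<otimes>\<^bsub>G\<^esub> g" k] kg k(1) by simp
    qed
  qed
qed

text \<open>
  Take bumps subordinate to open sets that are disjoint from their nontrivial translates. For
  each \<open>p\<close> some bump is nonzero at \<open>p\<close> and hence zero at all other points of its fibre, so a generic
  combination of the bumps separates the fibre. One dimension more than that of the ambient
  space of the charts is enough.
\<close>

lemma fibre_separating_map:
  obtains F :: "'p \<Rightarrow> 'e \<times> real" where "smooth_in P (points P) F"
    "\<And>p g. p \<in> points P \<Longrightarrow> g \<in> carrier G - {\<one>\<^bsub>G\<^esub>} \<Longrightarrow> F p \<noteq> F (\<sigma> p g)"
proof -
  define \<A> where "\<A> = {W. openin (mtop P) W \<and> (\<forall>x\<in>W. \<forall>g\<in>carrier G - {\<one>\<^bsub>G\<^esub>}. \<sigma> x g \<notin> W)}"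
  have 1: "openin (mtop P) W" if "W \<in> \<A>" for W
    using that by (simp add: \<A>_def)
  have 2: "points P \<subseteq> \<Union>\<A>"
  proof
    fix p assume "p \<in> points P"
    from small_neighbourhood[OF this] obtain W where "W \<in> \<A>" "p \<in> W" unfolding \<A>_def by blast
    then show "p \<in> \<Union>\<A>" by blast
  qed
  have "{} \<in> \<A>" by (simp add: \<A>_def)
  then have 3: "\<A> \<noteq> {}" by blast
  obtain \<psi> :: "nat \<Rightarrow> 'p \<Rightarrow> real" where \<psi>: "\<And>k. smooth_in P (points P) (\<psi> k)"
    "\<And>x. x \<in> points P \<Longrightarrow> \<exists>k. \<psi> k x \<noteq> 0"
    "\<And>k. \<exists>A\<in>\<A>. {x \<in> points P. \<psi> k x \<noteq> 0} \<subseteq> A"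
    "\<And>x. x \<in> points P \<Longrightarrow> \<exists>B k. openin (mtop P) B \<and> x \<in> B \<and> (\<forall>j\<ge>k. \<forall>y\<in>B. \<psi> j y = 0)"
    using locally_finite_bumps[OF smooth_P 1 2 3] by blast
  let ?T = "(\<lambda>g p. \<sigma> p g) ` (carrier G - {\<one>\<^bsub>G\<^esub>})"
  have dim: "DIM('e) < DIM('e \<times> real)" by simp
  have T: "finite ?T" using finite_G by simp
  have T': "smooth_map P P \<tau>" if "\<tau> \<in> ?T" for \<tau>
    using that smooth_act by blast
  obtain F :: "'p \<Rightarrow> 'e \<times> real" where F: "smooth_in P (points P) F"
    "\<And>\<tau> p k. \<tau> \<in> ?T \<Longrightarrow> p \<in> points P \<Longrightarrow> F p = F (\<tau> p) \<Longrightarrow> \<psi> k p = \<psi> k (\<tau> p)"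
    using generic_smooth_map[OF smooth_P dim T T' \<psi>(1) \<psi>(4)] by blast
  show ?thesis
  proof (rule that[OF F(1)])
    fix p g assume p: "p \<in> points P" and g: "g \<in> carrier G - {\<one>\<^bsub>G\<^esub>}"
    obtain k where k: "\<psi> k p \<noteq> 0" using \<psi>(2)[OF p] by blast
    obtain A where A: "A \<in> \<A>" "{x \<in> points P. \<psi> k x \<noteq> 0} \<subseteq> A" using \<psi>(3) by blast
    have "p \<in> A" using A(2) p k by blast
    then have "\<sigma> p g \<notin> A" using A(1) g by (auto simp: \<A>_def)
    then have "\<psi> k (\<sigma> p g) = 0" using A(2) act_points[OF _ p] g by blast
    then have "\<psi> k p \<noteq> \<psi> k (\<sigma> p g)" using k by simp
    then show "F p \<noteq> F (\<sigma> p g)"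
      using F(2)[of "\<lambda>p. \<sigma> p g" p k] p g by blast
  qed
qed

text \<open>
  The factor for \<open>g\<close> is \<open>\<langle>F x - F (x g), F y - F (x g)\<rangle> / |F x - F (x g)|\<^sup>2\<close>, which is 1 at \<open>y = x\<close> and
  0 at \<open>y = x g\<close>. It is affine in \<open>F y\<close>, hence of finite rank. Every point of the fibre other than \<open>x\<close>
  is killed by one of the finitely many factors.
\<close>

lemma separable_fibre_delta:
  obtains K where "separable_kernel P K"
    "\<And>x y. x \<in> points P \<Longrightarrow> y \<in> points P \<Longrightarrow> q x = q y \<Longrightarrow> K x y = (if x = y then 1 else 0)"
proof -
  interpret group G by (rule group_G)
  obtain F :: "'p \<Rightarrow> 'e \<times> real" where F: "smooth_in P (points P) F"
    and sep: "\<And>p g. p \<in> points P \<Longrightarrow> g \<in> carrier G - {\<one>\<^bsub>G\<^esub>} \<Longrightarrow> F p \<noteq> F (\<sigma> p g)"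
    using fibre_separating_map by blast
  define d where "d = (\<lambda>g x. F x - F (\<sigma> x g))"
  define u where "u = (\<lambda>g x. inverse (d g x \<bullet> d g x) *\<^sub>R d g x)"
  define L where "L = (\<lambda>g x y. complex_of_real (u g x \<bullet> F y + - (u g x \<bullet> F (\<sigma> x g))))"
  have sepL: "separable_kernel P (L g)" if g: "g \<in> carrier G - {\<one>\<^bsub>G\<^esub>}" for g
  proof -
    have Fg: "smooth_in P (points P) (\<lambda>x. F (\<sigma> x g))"
      using g act_points
      by (intro smooth_in_pullback[OF charted_P charted_P smooth_act openin_topspace F]) auto
    then have d: "smooth_in P (points P) (d g)"
      unfolding d_def by (intro smooth_in_diff F)
    then have "smooth_in P (points P) (u g)"
      unfolding u_def using sep[OF _ g]
      by (intro smooth_in_scaleR smooth_in_inverse[OF charted_P]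
          smooth_in_bilinear[OF bounded_bilinear_inner]) (auto simp: d_def)
    with Fg show ?thesis
      unfolding L_def
      by (intro separable_kernel_inner[OF charted_P _ F]
          smooth_in_linear[OF bounded_linear_minus[OF bounded_linear_ident]]
          smooth_in_bilinear[OF bounded_bilinear_inner])
  qed
  have L1: "L g x x = 1" if "x \<in> points P" "g \<in> carrier G - {\<one>\<^bsub>G\<^esub>}" for g x
  proof -
    have "d g x \<bullet> d g x \<noteq> 0" using sep[OF that] by (simp add: d_def)
    moreover have "u g x \<bullet> F x + - (u g x \<bullet> F (\<sigma> x g)) = u g x \<bullet> d g x"
      by (simp add: d_def inner_diff_right)
    moreover have "u g x \<bullet> d g x = inverse (d g x \<bullet> d g x) * (d g x \<bullet> d g x)"
      by (simp only: u_def inner_scaleR_left)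
    ultimately have "u g x \<bullet> F x + - (u g x \<bullet> F (\<sigma> x g)) = 1" by simp
    then show ?thesis by (simp only: L_def of_real_1)
  qed
  show ?thesis
  proof (rule that[of "\<lambda>x y. \<Prod>g\<in>carrier G - {\<one>\<^bsub>G\<^esub>}. L g x y"])
    show "separable_kernel P (\<lambda>x y. \<Prod>g\<in>carrier G - {\<one>\<^bsub>G\<^esub>}. L g x y)"
      by (intro separable_kernel_prod charted_P sepL)
    fix x y assume x: "x \<in> points P" and y: "y \<in> points P" "q x = q y"
    show "(\<Prod>g\<in>carrier G - {\<one>\<^bsub>G\<^esub>}. L g x y) = (if x = y then 1 else 0)"
    proof (cases "x = y")
      case True
      then show ?thesis using L1[OF x] by simp
    next
      case False
      obtain g where g: "g \<in> carrier G" "y = \<sigma> x g"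
        using act_transitive[OF x y(1)] y(2) by auto
      have "\<sigma> x \<one>\<^bsub>G\<^esub> = x"
        using principal x by (simp add: principal_bundle_def smooth_right_action_def)
      with False g have "g \<in> carrier G - {\<one>\<^bsub>G\<^esub>}" by auto
      moreover have "L g x y = 0" by (simp add: L_def g(2))
      ultimately have "(\<Prod>g\<in>carrier G - {\<one>\<^bsub>G\<^esub>}. L g x y) = 0"
        using finite_G by (intro prod_zero) auto
      then show ?thesis using False by simp
    qed
  qed
qed

definition fibre_sum :: "('p \<Rightarrow> complex) \<Rightarrow> 'm \<Rightarrow> complex" where
  "fibre_sum h = (\<lambda>m\<in>points M. \<Sum>p | p \<in> points P \<and> q p = m. h p)"

text \<open>
  Over a trivializing set the sum runs over the finitely many sheets.
\<close>

lemma fibre_sum_smooth: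
  assumes "smooth_in P (points P) h"
  shows "fibre_sum h \<in> smooth_functions M"
  unfolding fibre_sum_def
proof (intro restrict_smooth_functions charted_M smooth_in_local)
  fix m assume "m \<in> points M"
  then obtain U s where m: "m \<in> U" and U: "trivial_over U s"
    by (rule trivialization)
  note bij = trivial_overD(2)[OF U] and sm = trivial_overD(5)[OF U]
  have "smooth_in M U (\<lambda>x. \<Sum>g\<in>carrier G. h (s x g))"
    by (intro smooth_in_sum sm assms)
  moreover have "(\<Sum>p | p \<in> points P \<and> q p = x. h p) = (\<Sum>g\<in>carrier G. h (s x g))" if "x \<in> U" for x
    by (rule sum.reindex_bij_betw[OF bij[OF that], symmetric])
  ultimately have "smooth_in M U (\<lambda>x. \<Sum>p | p \<in> points P \<and> q p = x. h p)"
    by (subst smooth_in_cong[OF charted_M]) auto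
  then have "smooth_in M (points M \<inter> U) (\<lambda>x. \<Sum>p | p \<in> points P \<and> q p = x. h p)"
    by (rule smooth_in_subset) simp
  with m trivial_overD(1)[OF U] show "\<exists>U. openin (mtop M) U \<and> m \<in> U \<and>
      smooth_in M (points M \<inter> U) (\<lambda>x. \<Sum>p | p \<in> points P \<and> q p = x. h p)"
    by blast
qed

text \<open>
  If \<open>\<Sum>\<^bsub>b\<in>S\<^esub> a\<^sub>b \<otimes> b\<close> is the delta kernel of the fibres, then the members of \<open>S\<close> generate the module,
  with the fibre sums of \<open>a\<^sub>b h\<close> as the coefficients of \<open>h\<close>.
\<close>

lemma finitely_generated_projective:
  "finitely_generated_module (smooth_ring M) (smooth_module P q) \<and>
   projective_module TYPE('b) TYPE('c) (smooth_ring M) (smooth_module P q)"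
proof -
  let ?R = "smooth_ring M" and ?X = "smooth_module P q"
  note smP = smooth_functions_iff[OF charted_P]
  obtain K where "separable_kernel P K"
    and K: "\<And>x y. x \<in> points P \<Longrightarrow> y \<in> points P \<Longrightarrow> q x = q y \<Longrightarrow> K x y = (if x = y then 1 else 0)"
    using separable_fibre_delta by blast
  then obtain S a where S: "finite S" "S \<subseteq> smooth_functions P"
    and "\<forall>b\<in>S. smooth_in P (points P) (a b)"
    and "\<forall>x\<in>points P. \<forall>y\<in>points P. K x y = (\<Sum>b\<in>S. a b x * b y)"
    unfolding separable_kernel_def by (elim exE conjE)
  then have a: "\<And>b. b \<in> S \<Longrightarrow> smooth_in P (points P) (a b)"
    and Ka: "\<And>x y. x \<in> points P \<Longrightarrow> y \<in> points P \<Longrightarrow> K x y = (\<Sum>b\<in>S. a b x * b y)"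
    by simp_all
  define \<phi> where "\<phi> = (\<lambda>b h. fibre_sum (\<lambda>p. a b p * h p))"
  have \<phi>_in: "\<phi> b h \<in> smooth_functions M" if "b \<in> S" "h \<in> smooth_functions P" for b h
    unfolding \<phi>_def using that by (intro fibre_sum_smooth smooth_in_mult a) (auto simp: smP)
  show ?thesis
  proof (rule dual_basis_imp_projective[where S = S and \<phi> = \<phi>])
    show "Module.module ?R ?X"
      by (rule smooth_module_module[OF charted_P charted_M smooth_q])
    show "finite S" "S \<subseteq> carrier ?X"
      using S by (simp_all add: smooth_module_def)
    show "\<phi> b h \<in> carrier ?R" if "b \<in> S" "h \<in> carrier ?X" for b h
      using \<phi>_in that by (simp add: smooth_module_def smooth_ring_def)
    show "\<phi> b (h \<oplus>\<^bsub>?X\<^esub> h') = \<phi> b h \<oplus>\<^bsub>?R\<^esub> \<phi> b h'" for b h h'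
      by (auto simp: \<phi>_def fibre_sum_def smooth_module_def smooth_ring_def fun_eq_iff distrib_left
          simp flip: sum.distrib intro!: sum.cong)
    show "\<phi> b (r \<odot>\<^bsub>?X\<^esub> h) = r \<otimes>\<^bsub>?R\<^esub> \<phi> b h" for b r h
      by (auto simp: \<phi>_def fibre_sum_def smooth_module_def smooth_ring_def fun_eq_iff sum_distrib_left
          intro!: sum.cong)
    fix h assume "h \<in> carrier ?X"
    then have h: "h \<in> smooth_functions P" by (simp add: smooth_module_def)
    have "b \<in> S \<Longrightarrow> \<phi> b h \<odot>\<^bsub>?X\<^esub> b \<in> carrier ?X" for b
      using \<open>Module.module ?R ?X\<close> \<phi>_in[OF _ h] S(2)
      by (intro module.smult_closed) (auto simp: smooth_ring_def smooth_module_def)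
    then have "(\<Oplus>\<^bsub>?X\<^esub>b\<in>S. \<phi> b h \<odot>\<^bsub>?X\<^esub> b) = (\<lambda>p\<in>points P. \<Sum>b\<in>S. (\<phi> b h \<odot>\<^bsub>?X\<^esub> b) p)"
      by (intro finsum_smooth_functions[OF charted_P _ _ _ S(1)]) (auto simp: smooth_module_def)
    also have "\<dots> = h"
    proof (rule extensionalityI[of _ "points P"])
      show "h \<in> extensional (points P)" using h by (simp add: smP)
      fix p assume p: "p \<in> points P"
      let ?fib = "{p' \<in> points P. q p' = q p}"
      have "(\<lambda>p\<in>points P. \<Sum>b\<in>S. (\<phi> b h \<odot>\<^bsub>?X\<^esub> b) p) p = (\<Sum>b\<in>S. (\<Sum>p'\<in>?fib. a b p' * h p') * b p)"
        using p q_points[OF p] by (simp add: smooth_module_def \<phi>_def fibre_sum_def)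
      also have "\<dots> = (\<Sum>b\<in>S. \<Sum>p'\<in>?fib. a b p' * h p' * b p)"
        by (simp add: sum_distrib_right)
      also have "\<dots> = (\<Sum>p'\<in>?fib. \<Sum>b\<in>S. a b p' * h p' * b p)"
        by (rule sum.swap)
      also have "\<dots> = (\<Sum>p'\<in>?fib. (\<Sum>b\<in>S. a b p' * b p) * h p')"
        by (simp add: sum_distrib_left mult_ac)
      also have "\<dots> = (\<Sum>p'\<in>?fib. if p' = p then h p' else 0)"
        using K[of _ p] Ka[of _ p] p by (intro sum.cong) auto
      also have "\<dots> = h p"
        using finite_fibre[OF p] p by (simp add: sum.delta')
      finally show "(\<lambda>p\<in>points P. \<Sum>b\<in>S. (\<phi> b h \<odot>\<^bsub>?X\<^esub> b) p) p = h p" .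
    qed simp
    finally show "h = (\<Oplus>\<^bsub>?X\<^esub>b\<in>S. \<phi> b h \<odot>\<^bsub>?X\<^esub> b)" by simp
  qed
qed

end

theorem proposition8p5p2:
  fixes P :: "('p, 'e::euclidean_space) manifold"
    and M :: "('m, 'f::euclidean_space) manifold"
    and G :: "('g, 'h::euclidean_space) lie_group"
    and q :: "'p \<Rightarrow> 'm" and \<sigma> :: "'p \<Rightarrow> 'g \<Rightarrow> 'p"
  assumes "principal_bundle P M G q \<sigma>"
    and "finite (carrier G)"
  shows "finitely_generated_module (smooth_ring M) (smooth_module P q) \<and>
         projective_module TYPE('b) TYPE('c) (smooth_ring M) (smooth_module P q)"
proof -
  interpret finite_covering P M G q \<sigma>
    using assms by unfold_locales
  show ?thesis by (rule finitely_generated_projective)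
qed

end
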